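(* The degree for regular triples in $\mathbb{R}^k$ satisfies the following three properties: (Normalization) $\deg(I,\mathbb{R}^k,0)=1$, where $I$ denotes the identity on $\mathbb{R}^k$. (Additivity) If $(f,U,y)$ is a regular triple, and $U_1$ and $U_2$ are two disjoint open subsets of $U$ such that $f^{-1}(y)\cap U\subseteq U_1\cup U_2$, then $$\deg(f,U,y)=\deg(f,U_1,y)+\deg(f,U_2,y).$$ (Homotopy Invariance) If $(H,U,\alpha)$ is a smooth admissible homotopy joining two regular triples (that is, $(H(\cdot,0),U,\alpha(0))$ and $(H(\cdot,1),U,\alpha(1))$ are regular triples), then $$\deg(H(\cdot,0),U,\alpha(0))=\deg(H(\cdot,1),U,\alpha(1)).$$
   Context: Here $k$ is a positive integer, all maps are assumed continuous, and $\overline U$, $\partial U$ denote the closure and boundary of $U$ in $\mathbb{R}^k$. A map between metric spaces is proper if preimages of compact sets are compact. A function defined on an arbitrary subset $X$ of a Euclidean space is smooth ($C^\infty$) if it admits a $C^\infty$ extension to an open neighborhood of $X$. Triples: $(f,U,y)$ consists of an open set $U\subseteq\mathbb{R}^k$, an $\mathbb{R}^k$-valued map $f$ defined (at least) on $\overline U$, and $y\in\mathbb{R}^k$. It is admissible if $f$ is proper on $\overline U$ (i.e. $f|_{\overline U}$ is proper) and $f(x)\neq y$ for all $x\in\partial U$. It is regular if it is admissible, $f$ is $C^\infty$, and $y$ is a regular value for $f$ in $U$ (i.e. $\det f'(x)\ne0$ for all $x\in f^{-1}(y)\cap U$). For a regular triple the set $f^{-1}(y)\cap U$ is finite. Index: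 if $f$ is Fréchet differentiable at $x$ with invertible derivative, $\mathrm{i}(f,x):=\mathrm{sign}(\det f'(x))\in\{1,-1\}$. Degree of a regular triple: $\deg(f,U,y):=\sum_{x\in f^{-1}(y)\cap U}\mathrm{i}(f,x)$. Homotopies: $(H,U,\alpha)$, where $U\subseteq\mathbb{R}^k$ is open, $H$ is an $\mathbb{R}^k$-valued map defined (at least) on $\overline U\times[0,1]$ and $\alpha:[0,1]\to\mathbb{R}^k$ is a path, is a homotopy of triples joining $(H(\cdot,0),U,\alpha(0))$ with $(H(\cdot,1),U,\alpha(1))$. It is admissible if $H$ is proper on $\overline U\times[0,1]$ and $H(x,\lambda)\neq\alpha(\lambda)$ for all $(x,\lambda)\in\partial U\times[0,1]$. It is smooth if both $H$ and $\alpha$ are smooth. *)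

theory Defs
  imports "HOL-Analysis.Analysis"
begin

text \<open>A map is of class \<open>C\<^sup>n\<close> on an open set, by recursion on \<open>n\<close>: it is differentiable and all its
  directional derivatives \<open>x \<mapsto> f'(x) v\<close> are of class \<open>C\<^sup>n\<^sup>-\<^sup>1\<close>. This is meant for open
  \<open>S\<close> only, since derivatives are taken in the full space.\<close>

primrec Ck_on :: "nat \<Rightarrow> ('a::euclidean_space \<Rightarrow> 'b::euclidean_space) \<Rightarrow> 'a set \<Rightarrow> bool" where
  "Ck_on 0 f S \<longleftrightarrow> continuous_on S f"
| "Ck_on (Suc n) f S \<longleftrightarrow>
     (\<forall>x\<in>S. f differentiable (at x)) \<and> (\<forall>v. Ck_on n (\<lambda>x. frechet_derivative f (at x) v) S)"

definition smooth_on :: "('a::euclidean_space \<Rightarrow> 'b::euclidean_space) \<Rightarrow> 'a set \<Rightarrow> bool" where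
  "smooth_on f X \<longleftrightarrow>
     (\<exists>V g. open V \<and> X \<subseteq> V \<and> (\<forall>n. Ck_on n g V) \<and> (\<forall>x\<in>X. g x = f x))"

definition proper_on :: "('a::metric_space \<Rightarrow> 'b::metric_space) \<Rightarrow> 'a set \<Rightarrow> bool" where
  "proper_on f X \<longleftrightarrow> (\<forall>K. compact K \<longrightarrow> compact (f -` K \<inter> X))"

text \<open>Partial maps are represented by total functions; only the values on \<open>closure U\<close>
  (respectively \<open>closure U \<times> {0..1}\<close>) are constrained.\<close>

definition admissible_triple ::
    "(real^'k \<Rightarrow> real^'k) \<Rightarrow> (real^'k) set \<Rightarrow> real^'k \<Rightarrow> bool" where
  "admissible_triple f U y \<longleftrightarrow>
     open U \<and> continuous_on (closure U) f \<and> proper_on f (closure U) \<and> (\<forall>x\<in>frontier U. f x \<noteq> y)"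

definition regular_triple ::
    "(real^'k \<Rightarrow> real^'k) \<Rightarrow> (real^'k) set \<Rightarrow> real^'k \<Rightarrow> bool" where
  "regular_triple f U y \<longleftrightarrow>
     admissible_triple f U y \<and> smooth_on f (closure U) \<and>
     (\<forall>x \<in> f -` {y} \<inter> U. det (jacobian f (at x)) \<noteq> 0)"

text \<open>The value \<open>0\<close> is only taken at points where the derivative is singular, or fails to exist.\<close>

definition local_index :: "(real^'k \<Rightarrow> real^'k) \<Rightarrow> real^'k \<Rightarrow> int" where
  "local_index f x =
     (if f differentiable (at x) then \<lfloor>sgn (det (jacobian f (at x)))\<rfloor> else 0)"

definition deg :: "(real^'k \<Rightarrow> real^'k) \<Rightarrow> (real^'k) set \<Rightarrow> real^'k \<Rightarrow> int" where
  "deg f U y = (\<Sum>x \<in> f -` {y} \<inter> U. local_index f x)"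

definition admissible_homotopy ::
    "((real^'k) \<times> real \<Rightarrow> real^'k) \<Rightarrow> (real^'k) set \<Rightarrow> (real \<Rightarrow> real^'k) \<Rightarrow> bool" where
  "admissible_homotopy H U \<alpha> \<longleftrightarrow>
     open U \<and> continuous_on (closure U \<times> {0..1}) H \<and> path \<alpha> \<and>
     proper_on H (closure U \<times> {0..1}) \<and>
     (\<forall>x \<in> frontier U. \<forall>t \<in> {0..1}. H (x, t) \<noteq> \<alpha> t)"

definition smooth_homotopy ::
    "((real^'k) \<times> real \<Rightarrow> real^'k) \<Rightarrow> (real^'k) set \<Rightarrow> (real \<Rightarrow> real^'k) \<Rightarrow> bool" where
  "smooth_homotopy H U \<alpha> \<longleftrightarrow> smooth_on H (closure U \<times> {0..1}) \<and> smooth_on \<alpha> {0..1}"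


text \<open>The following facts show that every degree occurring in the three properties is the degree of
  a regular triple, and that the sum defining it is finite with summands \<open>1\<close> or \<open>-1\<close>.\<close>

lemma smooth_on_subset: "smooth_on f X \<Longrightarrow> Y \<subseteq> X \<Longrightarrow> smooth_on f Y"
  unfolding smooth_on_def by (meson order_trans subsetD)

lemma smooth_on_imp_differentiable:
  assumes "smooth_on f X" "open S" "S \<subseteq> X" "x \<in> S"
  shows "f differentiable (at x)"
proof -
  obtain V g where g: "open V" "X \<subseteq> V" "\<And>n. Ck_on n g V" "\<And>x. x \<in> X \<Longrightarrow> g x = f x"
    using assms(1) unfolding smooth_on_def by blast
  have "g differentiable (at x)"
    using g(3)[of 1] g(2) assms(3,4) by auto
  then obtain g' where "(g has_derivative g') (at x)"
    unfolding differentiable_def by blast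
  then have "(f has_derivative g') (at x)"
    by (rule has_derivative_transform_within_open[OF _ assms(2,4)]) (use g(4) assms(3) in auto)
  then show ?thesis
    unfolding differentiable_def by blast
qed

lemma smooth_on_id: "smooth_on (\<lambda>x::'a::euclidean_space. x) X"
proof -
  have const: "Ck_on n (\<lambda>x::'a. c::'a) UNIV" for n c
    by (induction n arbitrary: c) (auto simp: frechet_derivative_const)
  have "Ck_on n (\<lambda>x::'a. x) UNIV" for n
    by (cases n) (auto simp: const frechet_derivative_ident)
  then show ?thesis
    unfolding smooth_on_def by (intro exI[of _ UNIV] exI[of _ "\<lambda>x. x"]) auto
qed

lemma regular_triple_differentiable:
  assumes "regular_triple f U y" "x \<in> U"
  shows "f differentiable (at x)"
  using smooth_on_imp_differentiable[of f "closure U" U x] assms closure_subset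
  unfolding regular_triple_def admissible_triple_def by auto

lemma regular_triple_local_index:
  assumes "regular_triple f U y" "x \<in> f -` {y} \<inter> U"
  shows "local_index f x \<in> {1, -1}"
proof -
  have "\<lfloor>- 1::real\<rfloor> = - 1" by linarith
  then show ?thesis
    using assms regular_triple_differentiable[OF assms(1), of x]
    unfolding local_index_def regular_triple_def by (auto simp: sgn_if)
qed

lemma isolated_preimage:
  fixes f :: "real^'k \<Rightarrow> real^'k"
  assumes "f differentiable (at a)" "det (jacobian f (at a)) \<noteq> 0"
  shows "\<not> a islimpt {x. f x = f a}"
proof -
  let ?f' = "\<lambda>h. jacobian f (at a) *v h"
  have der: "(f has_derivative ?f') (at a)"
    using assms(1) jacobian_works by blast
  have lin: "linear ?f'" and inj: "inj ?f'"
    using assms(2) by (auto simp: inj_matrix_vector_mult invertible_det_nz)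
  obtain B where B: "B > 0" "\<And>h. B * norm h \<le> norm (?f' h)"
    using linear_inj_bounded_below_pos[OF lin inj] by blast
  obtain d where d: "d > 0"
      "\<And>z. norm (z - a) < d \<Longrightarrow> norm (f z - f a - ?f' (z - a)) \<le> B/2 * norm (z - a)"
    using der B(1) unfolding has_derivative_at_alt by (meson half_gt_zero)
  have "z = a" if "f z = f a" "dist z a < d" for z
  proof -
    have "norm (?f' (z - a)) \<le> B/2 * norm (z - a)"
      using d(2)[of z] that by (simp add: dist_norm)
    with B(2)[of "z - a"] have "B * norm (z - a) \<le> B/2 * norm (z - a)" by linarith
    with B(1) have "norm (z - a) \<le> 0" by (simp add: mult_le_cancel_right)
    then show ?thesis by simp
  qed
  then show ?thesis
    using d(1) unfolding islimpt_approachable by blast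
qed

lemma regular_triple_finite:
  assumes R: "regular_triple f U y"
  shows "finite (f -` {y} \<inter> U)"
proof (rule ccontr)
  assume inf: "infinite (f -` {y} \<inter> U)"
  have A: "admissible_triple f U y" using R unfolding regular_triple_def by auto
  have eq: "f -` {y} \<inter> closure U = f -` {y} \<inter> U"
    using A unfolding admissible_triple_def frontier_def
    by (auto simp: interior_open) (use closure_subset in blast)
  have "compact (f -` {y} \<inter> U)"
    using A eq unfolding admissible_triple_def proper_on_def by (metis compact_sing)
  then obtain a where a: "a \<in> f -` {y} \<inter> U" "a islimpt (f -` {y} \<inter> U)"
    using Heine_Borel_imp_Bolzano_Weierstrass inf by blast
  have "a islimpt {x. f x = f a}"
    by (rule islimpt_subset[OF a(2)]) (use a(1) in auto)
  then show False
    using isolated_preimage[of f a] a(1) regular_triple_differentiable[OF R, of a] R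
    unfolding regular_triple_def by blast
qed

lemma regular_triple_id: "regular_triple (\<lambda>x::real^'k. x) UNIV y"
proof -
  have "jacobian (\<lambda>x::real^'k. x) (at x) = mat 1" for x
    by (simp add: jacobian_def frechet_derivative_ident matrix_id_mat_1[unfolded id_def])
  then show ?thesis
    unfolding regular_triple_def admissible_triple_def proper_on_def
    by (auto simp: smooth_on_id frontier_def vimage_def)
qed

lemma regular_triple_restrict:
  assumes R: "regular_triple f U y" and o: "open U1" "open U2"
    and s: "U1 \<subseteq> U" "U1 \<inter> U2 = {}" "f -` {y} \<inter> U \<subseteq> U1 \<union> U2"
  shows "regular_triple f U1 y"
proof -
  have A: "admissible_triple f U y" using R unfolding regular_triple_def by auto
  have cl: "closure U1 \<subseteq> closure U" by (rule closure_mono[OF s(1)])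
  have bd: "f x \<noteq> y" if x: "x \<in> frontier U1" for x
  proof
    assume fx: "f x = y"
    have "x \<in> closure U1" "x \<notin> U1"
      using x o(1) by (auto simp: frontier_def interior_open)
    moreover have "x \<in> U"
      using A fx calculation cl unfolding admissible_triple_def frontier_def
      by (auto simp: interior_open)
    ultimately have "x \<in> U2" "x \<in> closure U1" using s(3) fx by auto
    then show False
      using o(2) s(2) open_Int_closure_eq_empty by blast
  qed
  have "compact (f -` K \<inter> closure U1)" if "compact K" for K
  proof -
    have "compact ((f -` K \<inter> closure U) \<inter> closure U1)"
      using A that unfolding admissible_triple_def proper_on_def
      by (meson compact_Int_closed closed_closure)
    then show ?thesis using cl by (simp add: Int_assoc inf.absorb2)
  qed
  moreover have "continuous_on (closure U1) f" "smooth_on f (closure U1)"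
    using A R cl unfolding admissible_triple_def regular_triple_def
    by (auto intro: continuous_on_subset smooth_on_subset)
  moreover have "\<forall>x \<in> f -` {y} \<inter> U1. det (jacobian f (at x)) \<noteq> 0"
    using R s(1) unfolding regular_triple_def by auto
  ultimately show ?thesis
    using bd o(1) unfolding regular_triple_def admissible_triple_def proper_on_def by simp
qed

end

theory Submission
  imports Defs
begin

text \<open>For the radial bump \<open>b r y = max 0 (r\<^sup>2 - |y|\<^sup>2)\<^sup>2\<close> with small \<open>r\<close>, the degree of a regular triple
  \<open>(f, U, y)\<close> times the integral of \<open>b r\<close> equals the integral over \<open>U\<close> of \<open>b r (f x - y) * det (f' x)\<close>.
  Along a smooth admissible homotopy the time derivative of this integrand is a divergence of compactly
  supported functions, so the integral is constant. The same invariance yields the degree formula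
  itself, without a change of variables: near a zero, \<open>f\<close> is deformed to its linearization, and Gram-Schmidt deforms the
  linearization to an orthogonal matrix, for which the integrand is \<open>b r\<close> up to the sign.\<close>

section \<open>Determinants as functions of their rows\<close>

text \<open>At intermediate times of a homotopy the value need not be regular: zeros may merge,
  disappear or accumulate, so they cannot be counted along the way, whereas the integral makes sense
  at every time. It is the integral of the pullback of the k-form b dy under x -> f(x) - y. That its
  time derivative is a divergence is Cartan's formula: the derivative of the pullback of a closed
  form is the exterior derivative of the pulled-back contraction with the velocity. This is carried
  out here in coordinates. The partial derivatives of the map serve as rows of a matrix, which is
  thus the transposed Jacobian matrix, and replacing a row is a function update. Only second
  derivatives of the map and one derivative of the bump enter, so a bump of class C^1 suffices. The
  set U may be unbounded. Properness confines the integrand to a compact subset of U once r is below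
  the norm of the map off that subset. Near a zero the same bound has to hold along the whole
  segment from f to its linearization, on a thin shell around the zero.\<close>

lemma det_row_linear:
  fixes c :: "'n::finite \<Rightarrow> real^'n"
  shows "linear (\<lambda>v. det (vec_lambda (c(i := v))))"
proof (rule linearI)
  show "det (vec_lambda (c(i := u + v))) = det (vec_lambda (c(i := u))) + det (vec_lambda (c(i := v)))" for u v
    using det_row_add[of i "\<lambda>_. u" "\<lambda>_. v" c] by (simp add: fun_upd_def)
  show "det (vec_lambda (c(i := r *\<^sub>R v))) = r *\<^sub>R det (vec_lambda (c(i := v)))" for r v
    using det_row_mul[of i r "\<lambda>_. v" c] by (simp add: fun_upd_def scalar_mult_eq_scaleR cong: if_cong)
qed

lemma det_swap_rows:
  fixes c :: "'n::finite \<Rightarrow> real^'n"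
  assumes "i \<noteq> j"
  shows "det (vec_lambda (c(i := v, j := w))) = - det (vec_lambda (c(i := w, j := v)))"
proof -
  let ?p = "Transposition.transpose i j"
  have "c(i := v, j := w) = (\<lambda>k. (c(i := w, j := v)) (?p k))"
    using assms by (auto simp: fun_eq_iff Transposition.transpose_def)
  then show ?thesis
    using det_permute_rows[of ?p "vec_lambda (c(i := w, j := v))"] assms
    by (simp add: permutes_swap_id sign_swap_id)
qed

text \<open>Both sides are the cofactor of the entry (\<open>i\<close>, \<open>m\<close>): in either
  expansion only the permutations with \<open>p i = m\<close> survive, and they contribute equal
  terms. This lets cofactors of rows be read as cofactors of columns.\<close>

lemma det_unit_row_eq_unit_column:
  fixes c :: "'n::finite \<Rightarrow> real^'n"
  shows "det (vec_lambda (c(i := axis m 1))) =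
    det (\<chi> k l. if l = m then if k = i then 1 else 0 else c k $ l)"
  unfolding det_def vec_lambda_beta
proof (rule sum.cong)
  fix p assume "p \<in> {p. p permutes (UNIV::'n set)}"
  then have p: "p permutes UNIV" by simp
  have "(\<Prod>k\<in>UNIV. (c(i := axis m 1)) k $ p k) =
        (\<Prod>k\<in>UNIV. if p k = m then if k = i then 1 else 0 else c k $ p k)"
  proof (cases "p i = m")
    case True
    then have "p k = m \<longleftrightarrow> k = i" for k
      using p by (metis permutes_univ)
    then show ?thesis
      by (intro prod.cong) (auto simp: True axis_def)
  next
    case False
    obtain k where k: "p k = m" using p by (metis permutes_univ)
    then have "k \<noteq> i" using False by auto
    have "(c(i := axis m 1)) i $ p i = 0" using False by (simp add: axis_def)
    then have "(\<Prod>k\<in>UNIV. (c(i := axis m 1)) k $ p k) = 0"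
      by (intro prod_zero) auto
    moreover have "(\<Prod>k\<in>UNIV. if p k = m then if k = i then 1 else 0 else c k $ p k) = (0::real)"
      using k \<open>k \<noteq> i\<close> by (intro prod_zero) auto
    ultimately show ?thesis by (simp only:)
  qed
  then show "of_int (sign p) * (\<Prod>k\<in>UNIV. (c(i := axis m 1)) k $ p k) =
        of_int (sign p) * (\<Prod>k\<in>UNIV. if p k = m then if k = i then 1 else 0 else c k $ p k)"
    by simp
qed simp

text \<open>Cramer's rule in a form free of division, hence valid for singular matrices too. In the
  divergence computation it turns a combination of the partial derivatives of the map into its time
  derivative.\<close>

lemma adjugate_identity:
  fixes c :: "'n::finite \<Rightarrow> real^'n"
  shows "(\<Sum>i\<in>UNIV. det (vec_lambda (c(i := v))) *\<^sub>R c i) = det (vec_lambda c) *\<^sub>R v"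
proof -
  define C where "C i m = det (vec_lambda (c(i := axis m 1)))" for i m
  have expand: "det (vec_lambda (c(i := v))) = (\<Sum>m\<in>UNIV. v$m * C i m)" for i
  proof -
    have "v = (\<Sum>m\<in>UNIV. v$m *\<^sub>R axis m 1)"
      using basis_expansion[of v] by (simp add: scalar_mult_eq_scaleR)
    then have "det (vec_lambda (c(i := v))) = det (vec_lambda (c(i := \<Sum>m\<in>UNIV. v$m *\<^sub>R axis m 1)))"
      by simp
    also have "\<dots> = (\<Sum>m\<in>UNIV. v$m * C i m)"
      unfolding C_def by (simp add: linear_sum[OF det_row_linear[of c i]] linear_cmul[OF det_row_linear[of c i]])
    finally show ?thesis .
  qed
  have col: "(\<Sum>i\<in>UNIV. C i m * c i $ l) = (if m = l then det (vec_lambda c) else 0)" for m l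
  proof -
    define d where "d k = (\<chi> i. c i $ k)" for k
    have trd: "det (\<chi> i k. if k = m then a $ i else c i $ k) = det (vec_lambda (d(m := a)))"
      for a :: "real^'n"
    proof -
      have "vec_lambda (d(m := a)) = Finite_Cartesian_Product.transpose (\<chi> i k. if k = m then a $ i else c i $ k)"
        by (auto simp: vec_eq_iff d_def Finite_Cartesian_Product.transpose_def)
      then show ?thesis by (simp only: det_transpose)
    qed
    \<comment> \<open>Read as column determinants, the cofactors summed against
      \<open>c i $ l\<close> substitute column \<open>l\<close> for column \<open>m\<close>; the
      result is the determinant itself or one with two equal columns.\<close>
    have "C i m = det (vec_lambda (d(m := axis i 1)))" for i
    proof -
      have "C i m = det (\<chi> k l. if l = m then axis i 1 $ k else c k $ l)"
        unfolding C_def det_unit_row_eq_unit_column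
        by (intro arg_cong[where f=det]) (auto simp: vec_eq_iff axis_def)
      then show ?thesis by (simp only: trd)
    qed
    then have "(\<Sum>i\<in>UNIV. C i m * c i $ l) = det (vec_lambda (d(m := \<Sum>i\<in>UNIV. c i $ l *\<^sub>R axis i 1)))"
      by (simp add: linear_sum[OF det_row_linear[of d m]] linear_cmul[OF det_row_linear[of d m]] mult.commute)
    also have "(\<Sum>i\<in>UNIV. c i $ l *\<^sub>R axis i 1) = d l"
      using basis_expansion[of "d l"] by (simp add: d_def scalar_mult_eq_scaleR)
    also have "det (vec_lambda (d(m := d l))) = (if m = l then det (vec_lambda c) else 0)"
    proof (cases "m = l")
      case True
      have "vec_lambda d = Finite_Cartesian_Product.transpose (vec_lambda c)"
        by (simp add: vec_eq_iff d_def Finite_Cartesian_Product.transpose_def)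
      then have "det (vec_lambda d) = det (vec_lambda c)" by (simp only: det_transpose)
      with True show ?thesis by simp
    next
      case False
      then show ?thesis
        by (simp add: det_identical_rows[of m l] row_def)
    qed
    finally show ?thesis .
  qed
  have "(\<Sum>i\<in>UNIV. det (vec_lambda (c(i := v))) * c i $ l) = det (vec_lambda c) * v $ l" for l
  proof -
    have "(\<Sum>i\<in>UNIV. det (vec_lambda (c(i := v))) * c i $ l) =
          (\<Sum>i\<in>UNIV. \<Sum>m\<in>UNIV. v$m * (C i m * c i $ l))"
      by (simp add: expand sum_distrib_right mult.assoc)
    also have "\<dots> = (\<Sum>m\<in>UNIV. v$m * (\<Sum>i\<in>UNIV. C i m * c i $ l))"
      by (subst sum.swap) (simp add: sum_distrib_left)
    also have "\<dots> = det (vec_lambda c) * v $ l"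
      by (simp add: col if_distrib[of "\<lambda>x. _ * x"] cong: if_cong)
    finally show ?thesis .
  qed
  then show ?thesis by (simp add: vec_eq_iff)
qed

text \<open>Product rule in each term of the Leibniz expansion, regrouped by the differentiated row.
  The filter is \<open>within S\<close> so that the one-sided time derivatives at 0 and 1 are
  covered.\<close>

lemma has_real_derivative_det:
  fixes c :: "'n::finite \<Rightarrow> real \<Rightarrow> real^'n"
  assumes "\<And>j. (c j has_vector_derivative c' j) (at z within S)"
  shows "((\<lambda>s. det (\<chi> j. c j s)) has_real_derivative
          (\<Sum>j\<in>UNIV. det (vec_lambda ((\<lambda>j. c j z)(j := c' j))))) (at z within S)"
proof -
  have comp: "((\<lambda>s. c j s $ l) has_derivative (\<lambda>h. h * c' j $ l)) (at z within S)" for j l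
    using bounded_linear.has_derivative[OF bounded_linear_vec_nth, OF assms[unfolded has_vector_derivative_def]]
    by simp
  have split: "(\<Prod>i\<in>UNIV. ((\<lambda>j. c j z)(j := c' j)) i $ p i) = c' j $ p j * (\<Prod>i\<in>UNIV-{j}. c i z $ p i)" for j and p :: "'n\<Rightarrow>'n"
    by (subst prod.remove[of _ j]) (auto intro!: prod.cong)
  have "((\<lambda>s. det (\<chi> j. c j s)) has_derivative
      (\<lambda>h. \<Sum>p | p permutes (UNIV::'n set). of_int (sign p) *
           (\<Sum>j\<in>UNIV. h * c' j $ p j * (\<Prod>i\<in>UNIV-{j}. c i z $ p i)))) (at z within S)"
    unfolding det_def vec_lambda_beta
    by (intro has_derivative_sum has_derivative_mult_right has_derivative_prod comp)
  moreover have "(\<Sum>p | p permutes (UNIV::'n set). of_int (sign p) *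
           (\<Sum>j\<in>UNIV. h * c' j $ p j * (\<Prod>i\<in>UNIV-{j}. c i z $ p i))) =
        (\<Sum>j\<in>UNIV. det (vec_lambda ((\<lambda>j. c j z)(j := c' j)))) * h" for h
  proof -
    have "(\<Sum>p | p permutes (UNIV::'n set). of_int (sign p) *
           (\<Sum>j\<in>UNIV. h * c' j $ p j * (\<Prod>i\<in>UNIV-{j}. c i z $ p i))) =
       (\<Sum>j\<in>UNIV. \<Sum>p | p permutes (UNIV::'n set). of_int (sign p) *
            (h * c' j $ p j * (\<Prod>i\<in>UNIV-{j}. c i z $ p i)))"
      by (subst sum.swap) (simp add: sum_distrib_left)
    also have "\<dots> = (\<Sum>j\<in>UNIV. det (vec_lambda ((\<lambda>j. c j z)(j := c' j))) * h)"
      unfolding det_def vec_lambda_beta split by (simp add: sum_distrib_left mult_ac)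
    finally show ?thesis by (simp add: sum_distrib_right)
  qed
  ultimately show ?thesis
    by (simp add: has_field_derivative_def)
qed

lemma continuous_on_det_rows:
  fixes c :: "'n::finite \<Rightarrow> 'a::topological_space \<Rightarrow> real^'n"
  assumes "\<And>j. continuous_on S (c j)"
  shows "continuous_on S (\<lambda>x. det (\<chi> j. c j x))"
  unfolding det_def vec_lambda_beta by (intro continuous_intros assms)

text \<open>The terms with second space derivatives cancel in pairs: exchanging \<open>i\<close> and
  \<open>j\<close> swaps two rows and leaves \<open>R i j\<close> unchanged, so the determinant
  changes sign. On the diagonal the update by \<open>T i\<close> overwrites \<open>q\<close>, and
  just these terms remain.\<close>

lemma det_divergence_identity:
  fixes c T :: "'n::finite \<Rightarrow> real^'n" and R :: "'n \<Rightarrow> 'n \<Rightarrow> real^'n"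
  assumes sym: "\<And>i j. R i j = R j i"
  shows "(\<Sum>i\<in>UNIV. \<Sum>j\<in>UNIV. det (vec_lambda ((c(i := q))(j := if j = i then T i else R i j)))) =
         (\<Sum>j\<in>UNIV. det (vec_lambda (c(j := T j))))"
proof -
  \<comment> \<open>The off-diagonal part, set to 0 on the diagonal so that antisymmetry holds for
    all index pairs.\<close>
  define E where "E i j = (if j = i then 0 else det (vec_lambda (c(i := q, j := R i j))))" for i j
  have anti: "E j i = - E i j" for i j
  proof (cases "i = j")
    case False
    then have "E j i = det (vec_lambda (c(i := R i j, j := q)))"
      unfolding E_def sym[of j i] using False fun_upd_twist[of j i c q "R i j"] by simp
    then show ?thesis
      using det_swap_rows[OF False, of c q "R i j"] False by (simp add: E_def)
  qed (simp add: E_def)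
  have "(\<Sum>i\<in>UNIV. \<Sum>j\<in>UNIV. E i j) = (\<Sum>i\<in>UNIV. \<Sum>j\<in>UNIV. E j i)"
    by (rule sum.swap)
  also have "\<dots> = - (\<Sum>i\<in>UNIV. \<Sum>j\<in>UNIV. E i j)"
    unfolding sum_negf[symmetric] by (intro sum.cong refl anti)
  finally have E0: "(\<Sum>i\<in>UNIV. \<Sum>j\<in>UNIV. E i j) = 0" by simp
  have "det (vec_lambda ((c(i := q))(j := if j = i then T i else R i j))) =
        (if j = i then det (vec_lambda (c(i := T i))) else 0) + E i j" for i j
    by (simp add: E_def)
  then show ?thesis
    using E0 by (simp add: sum.distrib)
qed

section \<open>Integrals of compactly supported functions\<close>

text \<open>The sets \<open>U \<times> T\<close> and \<open>(- S) \<times> T\<close> cover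
  everything, and the extension is continuous on each. They are open only relative to
  \<open>UNIV \<times> T\<close>, because the parameter set will be \<open>{0..1}\<close>.\<close>

lemma continuous_on_zero_extension:
  fixes h :: "'a::t2_space \<Rightarrow> 'b::topological_space \<Rightarrow> 'c::real_normed_vector"
  assumes "open U" "compact S" "S \<subseteq> U"
    and cont: "continuous_on (U \<times> T) (\<lambda>(x, t). h x t)"
    and zero: "\<And>x t. x \<in> U - S \<Longrightarrow> t \<in> T \<Longrightarrow> h x t = 0"
  shows "continuous_on (UNIV \<times> T) (\<lambda>(x, t). if x \<in> U then h x t else 0)"
proof -
  let ?f = "\<lambda>(x, t). if x \<in> U then h x t else 0"
  have eq: "UNIV \<times> T = U \<times> T \<union> (- S) \<times> T"
    using assms(3) by auto
  have "closed S" using assms(2) by (rule compact_imp_closed)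
  have "openin (top_of_set (UNIV \<times> T)) (X \<times> T)" if "open X" for X :: "'a set"
  proof -
    have "X \<times> T = (UNIV \<times> T) \<inter> (X \<times> UNIV)" by auto
    moreover have "open (X \<times> (UNIV :: 'b set))" using that by (intro open_Times) auto
    ultimately show ?thesis by (metis openin_open_Int)
  qed
  then have "openin (top_of_set (U \<times> T \<union> (- S) \<times> T)) (U \<times> T)"
      "openin (top_of_set (U \<times> T \<union> (- S) \<times> T)) ((- S) \<times> T)"
    using assms(1) \<open>closed S\<close> unfolding eq[symmetric] by auto
  moreover have "continuous_on (U \<times> T) ?f"
    by (rule continuous_on_eq[OF cont]) auto
  moreover have "continuous_on ((- S) \<times> T) ?f"
    by (rule continuous_on_eq[of _ "\<lambda>_. 0"]) (use zero in auto)
  ultimately show ?thesis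
    unfolding eq by (rule continuous_on_Un_local_open)
qed

lemma integral_cbox_eq_UNIV:
  fixes f :: "'a::euclidean_space \<Rightarrow> 'b::banach"
  assumes "\<And>x. x \<notin> cbox a b \<Longrightarrow> f x = 0"
  shows "integral (cbox a b) f = integral UNIV f"
proof -
  have "f = (\<lambda>x. if x \<in> cbox a b then f x else 0)" using assms by auto
  then show ?thesis using integral_restrict_UNIV[of "cbox a b" f] by simp
qed

text \<open>Translating \<open>u\<close> in direction \<open>v\<close> does not change its integral; differentiate in the
  translation parameter.\<close>

lemma integral_directional_derivative_eq_0:
  fixes u u' :: "'a::euclidean_space \<Rightarrow> real"
  assumes cont: "continuous_on UNIV u" "continuous_on UNIV u'"
    and deriv: "\<And>x. ((\<lambda>s. u (x + s *\<^sub>R v)) has_real_derivative u' x) (at 0)"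
    and supp: "\<And>x s. x \<notin> cbox a b \<Longrightarrow> \<bar>s\<bar> \<le> 1 \<Longrightarrow> u (x + s *\<^sub>R v) = 0"
  shows "integral (cbox a b) u' = 0"
proof -
  have shift: "integral (cbox a b) (\<lambda>x. u (x + s *\<^sub>R v)) = integral UNIV u" if "\<bar>s\<bar> \<le> 1" for s
  proof -
    have "integral (cbox a b) (\<lambda>x. u (x + s *\<^sub>R v)) = integral (cbox (a + s *\<^sub>R v) (b + s *\<^sub>R v)) u"
      using integral_shift_cbox_plus[of a b u "s *\<^sub>R v"] by (simp add: o_def add.commute)
    also have "\<dots> = integral UNIV u"
    proof (rule integral_cbox_eq_UNIV)
      fix x assume "x \<notin> cbox (a + s *\<^sub>R v) (b + s *\<^sub>R v)"
      then have "x - s *\<^sub>R v \<notin> cbox a b"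
        by (auto simp: mem_box algebra_simps)
      from supp[OF this that] show "u x = 0" by simp
    qed
    finally show ?thesis .
  qed
  \<comment> \<open>The parameter interval has 0 in its interior, so the derivative within it is an
    ordinary one and can be compared with that of a constant.\<close>
  have "((\<lambda>s. integral (cbox a b) (\<lambda>x. u (x + s *\<^sub>R v))) has_field_derivative
      integral (cbox a b) (\<lambda>x. u' (x + 0 *\<^sub>R v))) (at 0 within {-1..1})"
  proof (rule leibniz_rule_field_derivative)
    fix s :: real and x
    have "((\<lambda>t. u ((x + s *\<^sub>R v) + t *\<^sub>R v)) has_real_derivative u' (x + s *\<^sub>R v)) (at 0)"
      by (rule deriv)
    then have "((\<lambda>t. u (x + (t + s) *\<^sub>R v)) has_real_derivative u' (x + s *\<^sub>R v)) (at 0)"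
      by (simp add: algebra_simps)
    then have "((\<lambda>t. u (x + t *\<^sub>R v)) has_real_derivative u' (x + s *\<^sub>R v)) (at s)"
      using DERIV_shift[of "\<lambda>t. u (x + t *\<^sub>R v)" "u' (x + s *\<^sub>R v)" 0 s] by simp
    then show "((\<lambda>t. u (x + t *\<^sub>R v)) has_real_derivative u' (x + s *\<^sub>R v)) (at s within {-1..1})"
      by (rule has_field_derivative_at_within)
  next
    show "(\<lambda>x. u (x + s *\<^sub>R v)) integrable_on cbox a b" for s
      by (intro integrable_continuous continuous_on_compose2[OF cont(1)] continuous_intros) auto
    show "continuous_on ({-1..1} \<times> cbox a b) (\<lambda>(s, x). u' (x + s *\<^sub>R v))"
      unfolding case_prod_beta
      by (intro continuous_on_compose2[OF cont(2)] continuous_intros) auto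
  qed auto
  from this[unfolded scaleR_zero_left add_0_right]
  have "((\<lambda>_. integral UNIV u) has_field_derivative integral (cbox a b) u') (at 0 within {-1..1})"
    by (rule has_field_derivative_transform_within[of _ _ _ _ 1]) (auto simp: shift)
  then have "((\<lambda>_. integral UNIV u) has_field_derivative integral (cbox a b) u') (at 0)"
    by (simp add: at_within_Icc_at)
  then show ?thesis
    using DERIV_unique DERIV_const by blast
qed

text \<open>The square makes the positive part continuously differentiable, and
  \<open>y \<bullet> y\<close> in place of the norm avoids a singularity at the origin. The total
  mass is not normalized: it appears as the same positive factor in every degree formula and cancels
  at the end.\<close>

definition bump :: "real \<Rightarrow> 'a::real_inner \<Rightarrow> real" where
  "bump r y = (max 0 (r\<^sup>2 - y \<bullet> y))\<^sup>2"

lemma bump_eq_0: "0 \<le> r \<Longrightarrow> r \<le> norm y \<Longrightarrow> bump r y = 0"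
  unfolding bump_def using power_mono[of r "norm y" 2] by (simp add: power2_norm_eq_inner)

lemma bump_norm_cong: "norm x = norm y \<Longrightarrow> bump r x = bump r y"
  unfolding bump_def by (simp add: power2_norm_eq_inner[symmetric])

lemma continuous_on_bump [continuous_intros]:
  "continuous_on S f \<Longrightarrow> continuous_on S (\<lambda>x. bump r (f x))"
  unfolding bump_def by (intro continuous_intros)

lemma has_real_derivative_max_0_square:
  "((\<lambda>s::real. (max 0 s)\<^sup>2) has_real_derivative 2 * max 0 x) (at x)"
proof -
  consider "x > 0" | "x < 0" | "x = 0" by linarith
  then show ?thesis
  proof cases
    case 1
    have "((\<lambda>s::real. s\<^sup>2) has_real_derivative 2 * x) (at x)"
      by (auto intro!: derivative_eq_intros)
    then have "((\<lambda>s::real. (max 0 s)\<^sup>2) has_real_derivative 2 * x) (at x)"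
      by (rule has_field_derivative_transform_within_open[of _ _ _ "{0<..}"]) (use 1 in auto)
    then show ?thesis using 1 by simp
  next
    case 2
    have "((\<lambda>s::real. (max 0 s)\<^sup>2) has_real_derivative 0) (at x)"
      by (rule has_field_derivative_transform_within_open[of "\<lambda>_. 0" _ _ "{..<0}"]) (use 2 in auto)
    then show ?thesis using 2 by simp
  next
    case 3
    have "((\<lambda>h::real. (max 0 h)\<^sup>2 / h) \<longlongrightarrow> 0) (at 0)"
    proof (rule tendsto_norm_zero_cancel, rule Lim_null_comparison[where g="\<lambda>h. \<bar>h\<bar>"])
      show "\<forall>\<^sub>F h in at 0. norm (norm ((max 0 h)\<^sup>2 / h :: real)) \<le> \<bar>h\<bar>"
        by (intro always_eventually allI) (auto simp: max_def power2_eq_square)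
    qed (auto intro!: tendsto_eq_intros)
    then show ?thesis
      using 3 by (simp add: has_field_derivative_def has_derivative_at DERIV_def flip: has_field_derivative_def)
  qed
qed

lemma has_real_derivative_bump:
  fixes y :: "real \<Rightarrow> 'a::real_inner"
  assumes "(y has_vector_derivative y') (at s within S)"
  shows "((\<lambda>s. bump r (y s)) has_real_derivative - 4 * max 0 (r\<^sup>2 - y s \<bullet> y s) * (y s \<bullet> y')) (at s within S)"
proof -
  have "((\<lambda>s. r\<^sup>2 - y s \<bullet> y s) has_real_derivative - (2 * (y s \<bullet> y'))) (at s within S)"
    using assms unfolding has_vector_derivative_def has_field_derivative_def
    by (auto intro!: derivative_eq_intros simp: inner_commute)
  from DERIV_chain2[OF has_real_derivative_max_0_square this, unfolded o_def] show ?thesis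
    unfolding bump_def by (simp add: algebra_simps)
qed

lemma integral_bump_pos:
  assumes "r > 0"
  shows "integral UNIV (bump r :: 'a::euclidean_space \<Rightarrow> real) > 0"
proof -
  obtain c where c: "cball (0::'a) r \<subseteq> cbox (-c) c"
    using bounded_subset_cbox_symmetric[OF bounded_cball] by blast
  have z: "bump r x = 0" if "x \<notin> cbox (-c) c" for x
    using that c assms by (intro bump_eq_0) (auto simp: subset_eq)
  have cont: "continuous_on X (bump r :: 'a \<Rightarrow> real)" for X
    using continuous_on_bump[OF continuous_on_id] by simp
  have "integral (cbox (-c) c) (bump r :: 'a \<Rightarrow> real) \<noteq> 0"
  proof
    assume "integral (cbox (-c) c) (bump r :: 'a \<Rightarrow> real) = 0"
    moreover have "(bump r :: 'a \<Rightarrow> real) integrable_on cbox (-c) c"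
      by (intro integrable_continuous cont)
    ultimately have hi: "(bump r has_integral 0) (cbox (-c) c)"
      by (simp add: has_integral_iff)
    have "0 \<in> cbox (-c) c" using c assms by (auto simp: subset_eq)
    \<comment> \<open>A continuous nonnegative function with integral 0 over a box vanishes there
      only if the box is nondegenerate; the ball of radius \<open>r\<close> inside it guarantees
      this.\<close>
    moreover have "box (-c) c \<noteq> {}"
    proof -
      have "\<forall>i\<in>Basis. 0 < c \<bullet> i"
      proof
        fix i :: 'a assume i: "i \<in> Basis"
        then have "r *\<^sub>R i \<in> cball 0 r" using assms by simp
        then have "r *\<^sub>R i \<in> cbox (-c) c" using c by blast
        then have "r \<le> c \<bullet> i" using i by (auto simp: mem_box)
        then show "0 < c \<bullet> i" using assms by linarith
      qed
      then have "0 \<in> box (-c) c" by (auto simp: mem_box)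
      then show ?thesis by auto
    qed
    ultimately have "bump r (0::'a) = 0"
      by (intro has_integral_0_cbox_imp_0[OF cont _ hi]) (simp_all add: bump_def)
    then show False using assms by (simp add: bump_def)
  qed
  moreover have "integral (cbox (-c) c) (bump r :: 'a \<Rightarrow> real) \<ge> 0"
    by (intro integral_nonneg integrable_continuous cont) (simp add: bump_def)
  ultimately show ?thesis
    using integral_cbox_eq_UNIV[of "-c" c "bump r :: 'a \<Rightarrow> real", OF z] by simp
qed

section \<open>Homotopy invariance of the integral\<close>

text \<open>\<open>P i\<close> and \<open>Q\<close> are the partial derivatives of \<open>G\<close>
  in space and time, \<open>R i j\<close> is the derivative of \<open>P j\<close> along axis
  \<open>i\<close>, and \<open>T i\<close> is the mixed derivative. With derivatives given as data,
  smooth homotopies and explicit deformations of linear maps become instances alike. Sharing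
  \<open>T\<close> between \<open>P_t\<close> and \<open>Q_x\<close> encodes the equality of mixed
  derivatives.\<close>

locale c2_homotopy =
  fixes U :: "(real^'k) set" and G Q :: "real^'k \<Rightarrow> real \<Rightarrow> real^'k"
    and P T :: "'k \<Rightarrow> real^'k \<Rightarrow> real \<Rightarrow> real^'k"
    and R :: "'k \<Rightarrow> 'k \<Rightarrow> real^'k \<Rightarrow> real \<Rightarrow> real^'k"
  assumes open_U: "open U"
    and G_x: "\<And>i x t. x \<in> U \<Longrightarrow> t \<in> {0..1} \<Longrightarrow>
      ((\<lambda>s. G (x + s *\<^sub>R axis i 1) t) has_vector_derivative P i x t) (at 0)"
    and G_t: "\<And>x t. x \<in> U \<Longrightarrow> t \<in> {0..1} \<Longrightarrow>
      (G x has_vector_derivative Q x t) (at t within {0..1})"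
    and P_x: "\<And>i j x t. x \<in> U \<Longrightarrow> t \<in> {0..1} \<Longrightarrow>
      ((\<lambda>s. P j (x + s *\<^sub>R axis i 1) t) has_vector_derivative R i j x t) (at 0)"
    and P_t: "\<And>j x t. x \<in> U \<Longrightarrow> t \<in> {0..1} \<Longrightarrow>
      (P j x has_vector_derivative T j x t) (at t within {0..1})"
    and Q_x: "\<And>i x t. x \<in> U \<Longrightarrow> t \<in> {0..1} \<Longrightarrow>
      ((\<lambda>s. Q (x + s *\<^sub>R axis i 1) t) has_vector_derivative T i x t) (at 0)"
    and R_sym: "\<And>i j x t. x \<in> U \<Longrightarrow> t \<in> {0..1} \<Longrightarrow> R i j x t = R j i x t"
    and cont_G: "continuous_on (U \<times> {0..1}) (\<lambda>(x, t). G x t)"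
    and cont_Q: "continuous_on (U \<times> {0..1}) (\<lambda>(x, t). Q x t)"
    and cont_P: "\<And>j. continuous_on (U \<times> {0..1}) (\<lambda>(x, t). P j x t)"
    and cont_T: "\<And>j. continuous_on (U \<times> {0..1}) (\<lambda>(x, t). T j x t)"
    and cont_R: "\<And>i j. continuous_on (U \<times> {0..1}) (\<lambda>(x, t). R i j x t)"
begin

text \<open>With \<open>w = bump r G \<cdot> det (P\<^sub>1, \<dots>, P\<^sub>k)\<close> and \<open>u\<^sub>i\<close> obtained from \<open>w\<close> by replacing \<open>P\<^sub>i\<close> by
  \<open>Q = \<partial>\<^sub>t G\<close>, one has \<open>\<partial>\<^sub>t w = \<Sum>\<^sub>i \<partial>\<^sub>i u\<^sub>i\<close>, whose integral over the space vanishes.\<close>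

lemma integral_bump_det_homotopy:
  assumes S: "compact S" "S \<subseteq> U" and r: "r > 0"
    and away: "\<And>x t. x \<in> U - S \<Longrightarrow> t \<in> {0..1} \<Longrightarrow> r \<le> norm (G x t)"
  shows "integral UNIV (\<lambda>x. if x \<in> U then bump r (G x 0) * det (\<chi> j. P j x 0) else 0) =
         integral UNIV (\<lambda>x. if x \<in> U then bump r (G x 1) * det (\<chi> j. P j x 1) else 0)"
proof -
  \<comment> \<open>\<open>b y v\<close> is the derivative of \<open>bump r\<close> at
    \<open>y\<close> in direction \<open>v\<close>.\<close>
  define b where "b y v = - 4 * max 0 (r\<^sup>2 - y \<bullet> y) * (y \<bullet> v)" for y v :: "real^'k"
  define w where "w x t = bump r (G x t) * det (\<chi> j. P j x t)" for x t
  define w' where "w' x t = b (G x t) (Q x t) * det (\<chi> j. P j x t) +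
      bump r (G x t) * (\<Sum>j\<in>UNIV. det (vec_lambda ((\<lambda>j. P j x t)(j := T j x t))))" for x t
  define u where "u i x t = bump r (G x t) * det (vec_lambda ((\<lambda>j. P j x t)(i := Q x t)))" for i x t
  define u' where "u' i x t = b (G x t) (P i x t) * det (vec_lambda ((\<lambda>j. P j x t)(i := Q x t))) +
      bump r (G x t) * (\<Sum>j\<in>UNIV. det (vec_lambda
        (((\<lambda>j. P j x t)(i := Q x t))(j := if j = i then T i x t else R i j x t))))" for i x t
  \<comment> \<open>Extension by zero moves everything to the whole space, where translates can be
    integrated; it stays continuous because the integrands vanish on \<open>U - S\<close>.\<close>
  define ext where "ext h = (\<lambda>x t. if x \<in> U then h x t else 0)" for h :: "real^'k \<Rightarrow> real \<Rightarrow> real"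

  have divergence: "(\<Sum>i\<in>UNIV. u' i x t) = w' x t" if xt: "x \<in> U" "t \<in> {0..1}" for x t
  proof -
    have lin: "linear (b y)" for y
      unfolding b_def by (intro linearI) (auto simp: inner_add_right algebra_simps)
    \<comment> \<open>Linearity of \<open>b\<close> in the direction gathers the sum into one
      direction vector, which Cramer's rule evaluates to a multiple of \<open>Q\<close>.\<close>
    have "(\<Sum>i\<in>UNIV. b (G x t) (P i x t) * det (vec_lambda ((\<lambda>j. P j x t)(i := Q x t)))) =
        b (G x t) (\<Sum>i\<in>UNIV. det (vec_lambda ((\<lambda>j. P j x t)(i := Q x t))) *\<^sub>R P i x t)"
      by (simp add: linear_sum[OF lin] linear_cmul[OF lin] mult.commute)
    also have "\<dots> = b (G x t) (Q x t) * det (\<chi> j. P j x t)"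
      unfolding adjugate_identity by (simp add: linear_cmul[OF lin])
    finally show ?thesis
      using det_divergence_identity[of "\<lambda>i j. R i j x t" "\<lambda>j. P j x t" "Q x t" "\<lambda>j. T j x t"] R_sym[OF xt]
      unfolding u'_def w'_def by (simp add: sum.distrib sum_distrib_left[symmetric])
  qed

  have b0: "b (G x t) v = 0" "bump r (G x t) = 0" if "x \<in> U - S" "t \<in> {0..1}" for x t v
  proof -
    have "r \<le> norm (G x t)" using away that by blast
    then show "bump r (G x t) = 0" using r by (intro bump_eq_0) auto
    show "b (G x t) v = 0"
      using power_mono[OF \<open>r \<le> norm (G x t)\<close>, of 2] r unfolding b_def
      by (simp add: power2_norm_eq_inner)
  qed

  note cont = cont_G[unfolded case_prod_beta] cont_Q[unfolded case_prod_beta]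
    cont_P[unfolded case_prod_beta] cont_T[unfolded case_prod_beta] cont_R[unfolded case_prod_beta]
  have cont_upd: "continuous_on (U \<times> {0..1}) (\<lambda>z. det (vec_lambda ((\<lambda>j. c j z)(i := v z))))"
    if "\<And>j. continuous_on (U \<times> {0..1}) (c j)" "continuous_on (U \<times> {0..1}) v"
    for c i and v :: "(real^'k) \<times> real \<Rightarrow> real^'k"
  proof -
    have "continuous_on (U \<times> {0..1}) (\<lambda>z. det (\<chi> j. (if j = i then v else c j) z))"
      using that by (intro continuous_on_det_rows) auto
    then show ?thesis
      by (rule continuous_on_eq) (auto intro!: arg_cong[where f=det] simp: vec_eq_iff)
  qed
  have cont_det: "continuous_on (U \<times> {0..1}) (\<lambda>z. det (\<chi> j. P j (fst z) (snd z)))"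
    by (intro continuous_on_det_rows cont)
  have cont_b: "continuous_on (U \<times> {0..1}) (\<lambda>z. b (g z) (v z))"
    if "continuous_on (U \<times> {0..1}) g" "continuous_on (U \<times> {0..1}) v"
    for g v :: "(real^'k) \<times> real \<Rightarrow> real^'k"
    unfolding b_def by (intro continuous_intros that)

  have cont_ext: "continuous_on (UNIV \<times> {0..1}) (\<lambda>(x, t). ext h x t)"
    if "continuous_on (U \<times> {0..1}) (\<lambda>z. h (fst z) (snd z))"
       "\<And>x t. x \<in> U - S \<Longrightarrow> t \<in> {0..1} \<Longrightarrow> h x t = 0" for h
    unfolding ext_def using that
    by (intro continuous_on_zero_extension[OF open_U S]) (auto simp: case_prod_beta)
  have cont_w: "continuous_on (UNIV \<times> {0..1}) (\<lambda>(x, t). ext w x t)"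
    by (rule cont_ext) (auto simp: w_def b0 intro!: continuous_intros cont cont_det)
  have cont_w': "continuous_on (UNIV \<times> {0..1}) (\<lambda>(x, t). ext w' x t)"
    by (rule cont_ext) (auto simp: w'_def b0 intro!: continuous_intros cont cont_det cont_b cont_upd)
  have cont_u: "continuous_on (UNIV \<times> {0..1}) (\<lambda>(x, t). ext (u i) x t)" for i
    by (rule cont_ext) (auto simp: u_def b0 intro!: continuous_intros cont cont_upd)
  have cont_u': "continuous_on (UNIV \<times> {0..1}) (\<lambda>(x, t). ext (u' i) x t)" for i
  proof (rule cont_ext)
    have double: "continuous_on (U \<times> {0..1}) (\<lambda>z. det (vec_lambda
        (((\<lambda>j. P j (fst z) (snd z))(i := Q (fst z) (snd z)))
          (j := if j = i then T i (fst z) (snd z) else R i j (fst z) (snd z)))))" for j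
    proof -
      have "continuous_on (U \<times> {0..1}) (\<lambda>z. det (vec_lambda
          ((\<lambda>l. (if l = i then Q else P l) (fst z) (snd z))(j := (if j = i then T i else R i j) (fst z) (snd z)))))"
        by (rule cont_upd) (auto intro: cont)
      then show ?thesis
        by (rule continuous_on_eq) (auto intro!: arg_cong[where f=det] simp: vec_eq_iff)
    qed
    have "continuous_on (U \<times> {0..1}) (\<lambda>z. det (vec_lambda ((\<lambda>j. P j (fst z) (snd z))(i := Q (fst z) (snd z)))))"
      by (intro cont_upd cont)
    then show "continuous_on (U \<times> {0..1}) (\<lambda>z. u' i (fst z) (snd z))"
      unfolding u'_def by (intro continuous_intros cont cont_b double)
  qed (auto simp: u'_def b0)
  have slice: "continuous_on X (\<lambda>x. h x t)"
    if "continuous_on (UNIV \<times> {0..1}) (\<lambda>(x, t). h x t)" "t \<in> {0..1}" for X t and h :: "real^'k \<Rightarrow> real \<Rightarrow> real"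
  proof -
    have "continuous_on X (\<lambda>x. (x, t))" "(\<lambda>x. (x, t)) ` X \<subseteq> UNIV \<times> {0..1}"
      using that(2) by (auto intro: continuous_on_Pair)
    from continuous_on_compose2[OF that(1) this] show ?thesis by simp
  qed

  have deriv_w: "((\<lambda>t. ext w x t) has_real_derivative ext w' x t) (at t within {0..1})"
    if t: "t \<in> {0..1}" for x t
  proof (cases "x \<in> U")
    case True
    have "((\<lambda>t. w x t) has_real_derivative w' x t) (at t within {0..1})"
      unfolding w_def w'_def b_def
      using DERIV_mult[OF has_real_derivative_bump[OF G_t[OF True t]]
          has_real_derivative_det[of "\<lambda>j. P j x", OF P_t[OF True t]]]
      by (simp add: mult.commute)
    with True show ?thesis by (simp add: ext_def)
  qed (simp add: ext_def)
  have deriv_u: "((\<lambda>s. ext (u i) (x + s *\<^sub>R axis i 1) t) has_real_derivative ext (u' i) x t) (at 0)"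
    if t: "t \<in> {0..1}" for i x t
  proof (cases "x \<in> U")
    case True
    let ?e = "axis i 1 :: real^'k"
    have "((\<lambda>s. det (\<chi> j. (if j = i then Q else P j) (x + s *\<^sub>R ?e) t)) has_real_derivative
        (\<Sum>j\<in>UNIV. det (vec_lambda ((\<lambda>j. (if j = i then Q else P j) (x + 0 *\<^sub>R ?e) t)
           (j := if j = i then T i x t else R i j x t))))) (at 0)"
      by (rule has_real_derivative_det) (use Q_x[OF True t] P_x[OF True t] in auto)
    moreover have "(\<chi> j. (if j = i then Q else P j) y t) = vec_lambda ((\<lambda>j. P j y t)(i := Q y t))" for y
      by (auto simp: vec_eq_iff)
    moreover have "(\<lambda>j. (if j = i then Q else P j) y t) = ((\<lambda>j. P j y t)(i := Q y t))" for y
      by auto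
    ultimately have "((\<lambda>s. det (vec_lambda ((\<lambda>j. P j (x + s *\<^sub>R ?e) t)(i := Q (x + s *\<^sub>R ?e) t)))) has_real_derivative
        (\<Sum>j\<in>UNIV. det (vec_lambda (((\<lambda>j. P j x t)(i := Q x t))
           (j := if j = i then T i x t else R i j x t))))) (at 0)"
      by simp
    from DERIV_mult[OF has_real_derivative_bump[OF G_x[OF True t]] this]
    have "((\<lambda>s. u i (x + s *\<^sub>R ?e) t) has_real_derivative u' i x t) (at 0)"
      unfolding u_def u'_def b_def by (simp add: mult.commute)
    moreover have "open ((\<lambda>s::real. x + s *\<^sub>R ?e) -` U)"
      by (intro continuous_open_vimage open_U continuous_intros)
    ultimately have "((\<lambda>s. ext (u i) (x + s *\<^sub>R ?e) t) has_real_derivative u' i x t) (at 0)"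
      by (rule has_field_derivative_transform_within_open) (use True in \<open>auto simp: ext_def\<close>)
    with True show ?thesis by (simp add: ext_def)
  next
    case False
    let ?e = "axis i 1 :: real^'k"
    \<comment> \<open>A point outside \<open>U\<close> lies in the open complement of
      \<open>S\<close>, on which the extended function is identically 0.\<close>
    have "open (- S)" using S(1) by (simp add: compact_imp_closed open_Compl)
    then have "open ((\<lambda>s::real. x + s *\<^sub>R ?e) -` (- S))"
      by (rule continuous_open_vimage) (intro continuous_intros)
    then have "((\<lambda>s. ext (u i) (x + s *\<^sub>R ?e) t) has_real_derivative 0) (at 0)"
      by (rule has_field_derivative_transform_within_open[of "\<lambda>_. 0", rotated])
        (use False S(2) t in \<open>auto simp: ext_def u_def b0\<close>)
    with False show ?thesis by (simp add: ext_def)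
  qed

  obtain \<rho> where \<rho>: "\<And>x. x \<in> S \<Longrightarrow> norm x \<le> \<rho>"
    using compact_imp_bounded[OF S(1)] unfolding bounded_iff by blast
  \<comment> \<open>The extra 1 leaves room for all translations by unit vectors with
    \<open>\<bar>s\<bar> \<le> 1\<close>, so that a single box serves for every direction and every
    time.\<close>
  obtain c where c: "cball (0::real^'k) (\<rho> + 1) \<subseteq> cbox (-c) c"
    using bounded_subset_cbox_symmetric[OF bounded_cball] by blast
  have off: "x + s *\<^sub>R axis i 1 \<notin> S" if "x \<notin> cbox (-c) c" "\<bar>s\<bar> \<le> 1" for x s i
  proof
    assume "x + s *\<^sub>R axis i 1 \<in> S"
    moreover have "norm x \<le> norm (x + s *\<^sub>R axis i 1) + norm (s *\<^sub>R axis i (1::real))"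
      using norm_triangle_ineq4[of "x + s *\<^sub>R axis i 1" "s *\<^sub>R axis i 1"] by simp
    ultimately have "norm x \<le> \<rho> + 1" using \<rho>[of "x + s *\<^sub>R axis i 1"] that(2) by simp
    then show False using c that(1) by (auto simp: subset_eq)
  qed
  have ext_0: "ext h x t = 0" if "x \<notin> cbox (-c) c" "t \<in> {0..1}"
    "\<And>x t. x \<in> U - S \<Longrightarrow> t \<in> {0..1} \<Longrightarrow> h x t = 0" for h x t
    using off[of x 0] that unfolding ext_def by auto

  have zero_u: "integral (cbox (-c) c) (\<lambda>x. ext (u' i) x t) = 0" if t: "t \<in> {0..1}" for i t
  proof (rule integral_directional_derivative_eq_0[where u = "\<lambda>x. ext (u i) x t"])
    show "ext (u i) (x + s *\<^sub>R axis i 1) t = 0" if "x \<notin> cbox (-c) c" "\<bar>s\<bar> \<le> 1" for x s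
      using off[OF that] t by (auto simp: ext_def u_def b0)
  qed (intro slice cont_u cont_u' deriv_u t)+
  have zero_w: "integral (cbox (-c) c) (\<lambda>x. ext w' x t) = 0" if t: "t \<in> {0..1}" for t
  proof -
    have "(\<lambda>x. ext w' x t) = (\<lambda>x. \<Sum>i\<in>UNIV. ext (u' i) x t)"
      using divergence[OF _ t] by (auto simp: ext_def)
    then show ?thesis
      using zero_u[OF t] by (simp add: integral_sum integrable_continuous slice[OF cont_u' t])
  qed

  have swap: "continuous_on ({0..1} \<times> X) (\<lambda>(t, x). ext w' x t)" for X
  proof -
    have "continuous_on ({0..1} \<times> X) (\<lambda>z. (snd z, fst z))"
        "(\<lambda>z. (snd z, fst z)) ` ({0..1} \<times> X) \<subseteq> UNIV \<times> {0..1}"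
      by (auto intro!: continuous_on_Pair continuous_on_fst continuous_on_snd continuous_on_id)
    from continuous_on_compose2[OF cont_w' this] show ?thesis by (simp add: case_prod_beta)
  qed
  have "((\<lambda>t. integral (cbox (-c) c) (\<lambda>x. ext w x t)) has_real_derivative 0) (at t within {0..1})"
    if t: "t \<in> {0..1}" for t
  proof -
    have "((\<lambda>t. integral (cbox (-c) c) (\<lambda>x. ext w x t)) has_real_derivative
        integral (cbox (-c) c) (\<lambda>x. ext w' x t)) (at t within {0..1})"
      by (rule leibniz_rule_field_derivative[OF deriv_w _ swap t])
        (auto intro!: integrable_continuous slice[OF cont_w])
    then show ?thesis by (simp only: zero_w[OF t])
  qed
  then have "\<exists>C. \<forall>t\<in>{0..1}. integral (cbox (-c) c) (\<lambda>x. ext w x t) = C"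
    by (intro has_field_derivative_zero_constant) auto
  then obtain C where C: "\<And>t. t \<in> {0..1} \<Longrightarrow> integral (cbox (-c) c) (\<lambda>x. ext w x t) = C"
    by blast
  have "integral UNIV (\<lambda>x. ext w x t) = C" if t: "t \<in> {0..1}" for t
    using integral_cbox_eq_UNIV[of "-c" c "\<lambda>x. ext w x t"] ext_0[OF _ t, of _ w] C[OF t]
    by (simp add: w_def b0)
  from this[of 0] this[of 1] show ?thesis
    unfolding ext_def w_def by simp
qed

end

section \<open>Straight-line homotopies and linear maps\<close>

locale c2_map =
  fixes U :: "(real^'k) set" and f :: "real^'k \<Rightarrow> real^'k"
    and p :: "'k \<Rightarrow> real^'k \<Rightarrow> real^'k" and q :: "'k \<Rightarrow> 'k \<Rightarrow> real^'k \<Rightarrow> real^'k"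
  assumes open_U: "open U"
    and f_x: "\<And>i x. x \<in> U \<Longrightarrow> ((\<lambda>s. f (x + s *\<^sub>R axis i 1)) has_vector_derivative p i x) (at 0)"
    and p_x: "\<And>i j x. x \<in> U \<Longrightarrow> ((\<lambda>s. p j (x + s *\<^sub>R axis i 1)) has_vector_derivative q i j x) (at 0)"
    and q_sym: "\<And>i j x. x \<in> U \<Longrightarrow> q i j x = q j i x"
    and cont_f: "continuous_on U f"
    and cont_p: "\<And>j. continuous_on U (p j)"
    and cont_q: "\<And>i j. continuous_on U (q i j)"

lemma c2_map_subset:
  assumes "c2_map U f p q" "open V" "V \<subseteq> U"
  shows "c2_map V f p q"
proof -
  interpret c2_map U f p q by fact
  show ?thesis
    by unfold_locales (use assms in \<open>auto intro!: f_x p_x q_sym continuous_on_subset[OF cont_f]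
        continuous_on_subset[OF cont_p] continuous_on_subset[OF cont_q]\<close>)
qed

text \<open>A homotopy affine in time inherits its space derivatives as combinations of those at the
  ends, and its time derivatives as their differences; the mixed derivatives agree
  automatically.\<close>

lemma c2_homotopy_straight_line:
  fixes U :: "(real^'k) set"
  assumes "c2_map U f0 p0 q0" "c2_map U f1 p1 q1"
  shows "c2_homotopy U (\<lambda>x t. (1 - t) *\<^sub>R f0 x + t *\<^sub>R f1 x) (\<lambda>x t. f1 x - f0 x)
    (\<lambda>i x t. (1 - t) *\<^sub>R p0 i x + t *\<^sub>R p1 i x) (\<lambda>i x t. p1 i x - p0 i x)
    (\<lambda>i j x t. (1 - t) *\<^sub>R q0 i j x + t *\<^sub>R q1 i j x)"
proof -
  interpret f0: c2_map U f0 p0 q0 by fact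
  interpret f1: c2_map U f1 p1 q1 by fact
  have comb: "((\<lambda>s. c *\<^sub>R u s + d *\<^sub>R v s) has_vector_derivative c *\<^sub>R u' + d *\<^sub>R v') F"
    if "(u has_vector_derivative u') F" "(v has_vector_derivative v') F"
    for c d and u v :: "real \<Rightarrow> real^'k" and u' v' F
    by (intro has_vector_derivative_add bounded_linear.has_vector_derivative[OF bounded_linear_scaleR_right] that)
  have line: "((\<lambda>s. (1 - s) *\<^sub>R a + s *\<^sub>R b) has_vector_derivative b - a) (at t within X)"
    for a b :: "real^'k" and t X
    unfolding has_vector_derivative_def
    by (auto intro!: derivative_eq_intros simp: algebra_simps)
  have fst_cont: "continuous_on (U \<times> {0..1}) (\<lambda>z. h (fst z))" if "continuous_on U h"
    for h :: "real^'k \<Rightarrow> real^'k"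
    by (rule continuous_on_compose2[OF that continuous_on_fst[OF continuous_on_id]]) auto
  show ?thesis
  proof
    show "open U" by (rule f0.open_U)
  qed (unfold case_prod_beta, auto simp: f0.q_sym f1.q_sym
      intro!: comb line has_vector_derivative_diff f0.f_x f1.f_x f0.p_x f1.p_x continuous_intros
        fst_cont f0.cont_f f1.cont_f f0.cont_p f1.cont_p f0.cont_q f1.cont_q)
qed

lemma integral_bump_det_straight_line:
  assumes f: "c2_map U f0 p0 q0" "c2_map U f1 p1 q1"
    and S: "compact S" "S \<subseteq> U" and r: "r > 0"
    and away: "\<And>x t. x \<in> U - S \<Longrightarrow> t \<in> {0..1} \<Longrightarrow> r \<le> norm ((1 - t) *\<^sub>R f0 x + t *\<^sub>R f1 x)"
  shows "integral UNIV (\<lambda>x. if x \<in> U then bump r (f0 x) * det (\<chi> j. p0 j x) else 0) =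
         integral UNIV (\<lambda>x. if x \<in> U then bump r (f1 x) * det (\<chi> j. p1 j x) else 0)"
proof -
  interpret c2_homotopy U "\<lambda>x t. (1 - t) *\<^sub>R f0 x + t *\<^sub>R f1 x" "\<lambda>x t. f1 x - f0 x"
    "\<lambda>i x t. (1 - t) *\<^sub>R p0 i x + t *\<^sub>R p1 i x" "\<lambda>i x t. p1 i x - p0 i x"
    "\<lambda>i j x t. (1 - t) *\<^sub>R q0 i j x + t *\<^sub>R q1 i j x"
    by (rule c2_homotopy_straight_line[OF f])
  show ?thesis
    using integral_bump_det_homotopy[OF S r away] by (simp cong: if_cong)
qed

section \<open>Affine maps and deformations of invertible matrices\<close>

lemma c2_map_affine:
  assumes "open U"
  shows "c2_map U (\<lambda>x. A *v (x - a)) (\<lambda>i x. column i A) (\<lambda>i j x. 0)"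
proof
  show "((\<lambda>s. A *v (x + s *\<^sub>R axis i 1 - a)) has_vector_derivative column i A) (at 0)" for i x
  proof -
    have "(\<lambda>s. A *v (x + s *\<^sub>R axis i 1 - a)) = (\<lambda>s. A *v (x - a) + s *\<^sub>R column i A)"
      by (auto simp: algebra_simps matrix_vector_mult_basis matrix_vector_mult_scaleR
          matrix_vector_right_distrib)
    then show ?thesis
      unfolding has_vector_derivative_def by (auto intro!: derivative_eq_intros)
  qed
  show "continuous_on U (\<lambda>x. A *v (x - a))"
    by (intro bounded_linear.continuous_on[OF matrix_vector_mul_bounded_linear] continuous_intros)
qed (use assms in \<open>auto simp: continuous_on_const\<close>)

lemma det_columns: "det (\<chi> j. column j A) = det (A :: real^'k^'k)"
proof -
  have "(\<chi> j. column j A) = Finite_Cartesian_Product.transpose A"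
    by (simp add: vec_eq_iff column_def Finite_Cartesian_Product.transpose_def)
  then show ?thesis by simp
qed

lemma matrix_bounded_below:
  assumes "det (A :: real^'k^'k) \<noteq> 0"
  obtains m where "m > 0" "\<And>x. m * norm x \<le> norm (A *v x)"
proof -
  have "linear ((*v) A)" "inj ((*v) A)"
    using assms by (auto simp: inj_matrix_vector_mult invertible_det_nz)
  then show ?thesis using linear_inj_bounded_below_pos that by blast
qed

text \<open>The norm of the image attains a positive minimum on the compact product of
  \<open>{0..1}\<close> with the unit sphere; homogeneity extends the bound to all vectors. The
  uniformity in \<open>t\<close> gives one compact support for the whole path.\<close>

lemma matrix_path_bounded_below:
  assumes det: "\<And>t. t \<in> {0..1} \<Longrightarrow> det ((1 - t) *\<^sub>R A + t *\<^sub>R B :: real^'k^'k) \<noteq> 0"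
  obtains m where "m > 0"
    "\<And>t x. t \<in> {0..1} \<Longrightarrow> m * norm x \<le> norm (((1 - t) *\<^sub>R A + t *\<^sub>R B) *v x)"
proof -
  define h where "h t x = ((1 - t) *\<^sub>R A + t *\<^sub>R B) *v x" for t x
  have h: "h t x = (1 - t) *\<^sub>R (A *v x) + t *\<^sub>R (B *v x)" for t x
    by (simp add: h_def matrix_vector_mult_add_rdistrib scaleR_matrix_vector_assoc)
  let ?K = "{0..1::real} \<times> sphere (0::real^'k) 1"
  have "continuous_on ?K (\<lambda>z. norm (h (fst z) (snd z)))"
    unfolding h by (intro continuous_intros bounded_linear.continuous_on[OF matrix_vector_mul_bounded_linear])
  moreover have "compact ?K" by (intro compact_Times) auto
  moreover have "?K \<noteq> {}" using vector_choose_size[of 1] by (auto intro: exI[of _ 0])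
  ultimately obtain z where z: "z \<in> ?K" "\<And>y. y \<in> ?K \<Longrightarrow> norm (h (fst z) (snd z)) \<le> norm (h (fst y) (snd y))"
    using continuous_attains_inf[of ?K "\<lambda>z. norm (h (fst z) (snd z))"] by blast
  let ?m = "norm (h (fst z) (snd z))"
  show ?thesis
  proof
    have "det ((1 - fst z) *\<^sub>R A + fst z *\<^sub>R B) \<noteq> 0" using det z(1) by (auto simp: mem_Times_iff)
    from matrix_bounded_below[OF this]
    obtain m where m: "m > 0" "\<And>x. m * norm x \<le> norm (h (fst z) x)"
      unfolding h_def by blast
    have "m \<le> ?m" using m(2)[of "snd z"] z(1) by (simp add: mem_Times_iff)
    with m(1) show "?m > 0" by linarith
    show "?m * norm x \<le> norm (((1 - t) *\<^sub>R A + t *\<^sub>R B) *v x)" if t: "t \<in> {0..1}" for t x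
    proof (cases "x = 0")
      case False
      have "?m \<le> norm (h t (x /\<^sub>R norm x))"
        using z(2)[of "(t, x /\<^sub>R norm x)"] t False by simp
      also have "h t (x /\<^sub>R norm x) = h t x /\<^sub>R norm x"
        by (simp add: h_def matrix_vector_mult_scaleR)
      finally show ?thesis using False by (simp add: h_def field_simps)
    qed simp
  qed
qed

text \<open>Only the first map carries the shift \<open>a\<close>, so the same segment changes the
  matrix and moves the centre to 0.\<close>

lemma integral_bump_matrix_path:
  assumes det: "\<And>t. t \<in> {0..1} \<Longrightarrow> det ((1 - t) *\<^sub>R A + t *\<^sub>R B :: real^'k^'k) \<noteq> 0" and r: "r > 0"
  shows "integral UNIV (\<lambda>x. bump r (A *v (x - a)) * det A) = integral UNIV (\<lambda>x. bump r (B *v x) * det B)"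
proof -
  obtain m where m: "m > 0" "\<And>t x. t \<in> {0..1} \<Longrightarrow> m * norm x \<le> norm (((1 - t) *\<^sub>R A + t *\<^sub>R B) *v x)"
    using matrix_path_bounded_below[OF det] by blast
  \<comment> \<open>Beyond this radius the linear part has norm at least
    \<open>r + norm (A *v a)\<close>, so at least \<open>r\<close> is left after the shift.\<close>
  define \<rho> where "\<rho> = (r + norm (A *v a)) / m"
  have "integral UNIV (\<lambda>x. if x \<in> UNIV then bump r (A *v (x - a)) * det (\<chi> j. column j A) else 0) =
      integral UNIV (\<lambda>x. if x \<in> UNIV then bump r (B *v (x - 0)) * det (\<chi> j. column j B) else 0)"
  proof (rule integral_bump_det_straight_line[OF c2_map_affine c2_map_affine, where S = "cball 0 \<rho>"])
    fix x :: "real^'k" and t :: real assume x: "x \<in> UNIV - cball 0 \<rho>" and t: "t \<in> {0..1}"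
    have "r + norm (A *v a) \<le> m * norm x"
      using x m(1) by (simp add: \<rho>_def field_simps)
    also have "\<dots> \<le> norm (((1 - t) *\<^sub>R A + t *\<^sub>R B) *v x)" by (rule m(2)[OF t])
    also have "((1 - t) *\<^sub>R A + t *\<^sub>R B) *v x =
        ((1 - t) *\<^sub>R (A *v (x - a)) + t *\<^sub>R (B *v (x - 0))) + (1 - t) *\<^sub>R (A *v a)"
      by (simp add: matrix_vector_mult_add_rdistrib scaleR_matrix_vector_assoc
          matrix_vector_mult_diff_distrib algebra_simps)
    also have "norm \<dots> \<le> norm ((1 - t) *\<^sub>R (A *v (x - a)) + t *\<^sub>R (B *v (x - 0))) + norm ((1 - t) *\<^sub>R (A *v a))"
      by (rule norm_triangle_ineq)
    also have "norm ((1 - t) *\<^sub>R (A *v a)) \<le> norm (A *v a)"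
      using t by (auto intro!: mult_left_le_one_le)
    finally show "r \<le> norm ((1 - t) *\<^sub>R (A *v (x - a)) + t *\<^sub>R (B *v (x - 0)))" by simp
  qed (use r in auto)
  then show ?thesis by (simp add: det_columns)
qed

text \<open>The determinant is linear in row \<open>i\<close>, so along the segment it is
  \<open>(1 - t) + t * \<mu>\<close> times its initial value; the positivity of \<open>\<mu>\<close>
  keeps it away from 0.\<close>

lemma integral_bump_row_change:
  fixes c :: "'k::finite \<Rightarrow> real^'k"
  assumes "det (vec_lambda (c(i := w))) = \<mu> * det (vec_lambda c)" "\<mu> > 0" "det (vec_lambda c) \<noteq> 0" "r > 0"
  shows "integral UNIV (\<lambda>x. bump r (vec_lambda c *v x) * det (vec_lambda c)) =
         integral UNIV (\<lambda>x. bump r (vec_lambda (c(i := w)) *v x) * det (vec_lambda (c(i := w))))"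
proof -
  have "det ((1 - t) *\<^sub>R vec_lambda c + t *\<^sub>R vec_lambda (c(i := w))) \<noteq> 0" if t: "t \<in> {0..1}" for t
  proof -
    have "(1 - t) *\<^sub>R vec_lambda c + t *\<^sub>R vec_lambda (c(i := w)) =
        vec_lambda (c(i := (1 - t) *\<^sub>R c i + t *\<^sub>R w))"
      by (auto simp: vec_eq_iff algebra_simps)
    moreover have "det (vec_lambda (c(i := (1 - t) *\<^sub>R c i + t *\<^sub>R w))) = ((1 - t) + t * \<mu>) * det (vec_lambda c)"
    proof -
      have "det (vec_lambda (c(i := (1 - t) *\<^sub>R c i + t *\<^sub>R w))) =
          (1 - t) * det (vec_lambda (c(i := c i))) + t * det (vec_lambda (c(i := w)))"
        by (simp only: linear_add[OF det_row_linear] linear_cmul[OF det_row_linear] real_scaleR_def)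
      then show ?thesis using assms(1) by (simp add: algebra_simps)
    qed
    moreover have "(1 - t) + t * \<mu> > 0"
      using t assms(2) by (cases "t = 1") (auto intro: add_pos_nonneg)
    ultimately show ?thesis using assms(3) by simp
  qed
  from integral_bump_matrix_path[OF this assms(4), of 0] show ?thesis by simp
qed

text \<open>Gram--Schmidt as a homotopy: each step replaces one row along a segment of invertible
  matrices. As \<open>bump\<close> is radial, nothing has to be computed for an orthogonal matrix.\<close>

lemma gram_schmidt_integral_bump:
  fixes A :: "real^'k^'k"
  assumes A: "det A \<noteq> 0" and r: "r > 0"
  shows "\<exists>c :: 'k \<Rightarrow> real^'k. det (vec_lambda c) \<noteq> 0 \<and> sgn (det (vec_lambda c)) = sgn (det A) \<and>
    (\<forall>i\<in>I. norm (c i) = 1) \<and> (\<forall>i\<in>I. \<forall>j\<in>I. i \<noteq> j \<longrightarrow> c i \<bullet> c j = 0) \<and>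
    integral UNIV (\<lambda>x. bump r (A *v x) * det A) =
    integral UNIV (\<lambda>x. bump r (vec_lambda c *v x) * det (vec_lambda c))"
proof -
  have "finite I" by simp
  then show ?thesis
  proof (induction I)
    case empty
    show ?case by (rule exI[of _ "($) A"]) (use A in \<open>simp add: vec_nth_inverse\<close>)
  next
    case (insert i I)
    from insert.IH show ?case
    proof (elim exE conjE)
      fix c :: "'k \<Rightarrow> real^'k"
      assume c: "det (vec_lambda c) \<noteq> 0" "sgn (det (vec_lambda c)) = sgn (det A)"
        "\<forall>i\<in>I. norm (c i) = 1" "\<forall>i\<in>I. \<forall>j\<in>I. i \<noteq> j \<longrightarrow> c i \<bullet> c j = 0"
        "integral UNIV (\<lambda>x. bump r (A *v x) * det A) =
         integral UNIV (\<lambda>x. bump r (vec_lambda c *v x) * det (vec_lambda c))"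
      define s where "s = (\<Sum>j\<in>I. (c i \<bullet> c j) *\<^sub>R c j)"
      define v where "v = c i - s"
      define d where "d = c(i := v /\<^sub>R norm v)"
      have "- s \<in> span {row j (vec_lambda c) |j. j \<noteq> i}"
        unfolding s_def using insert.hyps
        by (intro span_neg span_sum span_scale span_base) (auto simp: row_def)
      from det_row_span[of "- s" "vec_lambda c" i, unfolded span_vec_eq, OF this]
      have dv: "det (vec_lambda (c(i := v))) = det (vec_lambda c)"
        by (simp add: row_def v_def fun_upd_def cong: if_cong)
      \<comment> \<open>A zero row would make the determinant vanish.\<close>
      have "v \<noteq> 0"
        using dv c(1) linear_0[OF det_row_linear[of c i]] by auto
      \<comment> \<open>Projection preserves the determinant and normalization divides it by
        \<open>norm v\<close>, so both together form one admissible row change with positive factor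
        \<open>inverse (norm v)\<close>.\<close>
      have det_d: "det (vec_lambda d) = inverse (norm v) * det (vec_lambda c)"
        unfolding d_def using dv by (simp add: linear_cmul[OF det_row_linear])
      have orth: "v \<bullet> c j = 0" if j: "j \<in> I" for j
      proof -
        have "s \<bullet> c j = (\<Sum>l\<in>I. if l = j then c i \<bullet> c j else 0)"
          unfolding s_def inner_sum_left using c(3,4) j
          by (intro sum.cong) (auto simp: norm_eq_1)
        then show ?thesis using j insert.hyps by (simp add: v_def inner_diff_left)
      qed
      have "norm (d j) = 1" if "j \<in> insert i I" for j
        using that c(3) \<open>v \<noteq> 0\<close> by (auto simp: d_def)
      moreover have "d j \<bullet> d l = 0" if "j \<in> insert i I" "l \<in> insert i I" "j \<noteq> l" for j l
        using that c(4) orth insert.hyps by (auto simp: d_def inner_commute)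
      moreover have "integral UNIV (\<lambda>x. bump r (A *v x) * det A) =
          integral UNIV (\<lambda>x. bump r (vec_lambda d *v x) * det (vec_lambda d))"
        unfolding c(5) d_def
        by (rule integral_bump_row_change[OF det_d[unfolded d_def]]) (use \<open>v \<noteq> 0\<close> c(1) r in auto)
      moreover have "det (vec_lambda d) \<noteq> 0" "sgn (det (vec_lambda d)) = sgn (det A)"
        using det_d c(1,2) \<open>v \<noteq> 0\<close> by (auto simp: sgn_mult)
      ultimately show ?case by (intro exI[of _ d] conjI ballI impI)
    qed
  qed
qed

text \<open>The final matrix is orthogonal, so it preserves the radial bump, and its determinant is
  1 or -1 with the sign of \<open>det A\<close>.\<close>

lemma integral_bump_affine:
  fixes A :: "real^'k^'k"
  assumes A: "det A \<noteq> 0" and r: "r > 0"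
  shows "integral UNIV (\<lambda>x. bump r (A *v (x - a)) * det A) = sgn (det A) * integral UNIV (bump r :: real^'k \<Rightarrow> real)"
proof -
  obtain c :: "'k \<Rightarrow> real^'k" where c: "sgn (det (vec_lambda c)) = sgn (det A)"
    "\<And>i. norm (c i) = 1" "\<And>i j. i \<noteq> j \<Longrightarrow> c i \<bullet> c j = 0"
    "integral UNIV (\<lambda>x. bump r (A *v x) * det A) =
     integral UNIV (\<lambda>x. bump r (vec_lambda c *v x) * det (vec_lambda c))"
    using gram_schmidt_integral_bump[OF A r, of UNIV] by auto
  have om: "orthogonal_matrix (vec_lambda c)"
    unfolding orthogonal_matrix_orthonormal_rows using c(2,3) by (simp add: row_def orthogonal_def)
  then have "orthogonal_transformation ((*v) (vec_lambda c))"
    by (simp add: orthogonal_transformation_matrix)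
  then have "norm (vec_lambda c *v x) = norm x" for x
    by (rule orthogonal_transformation_norm)
  then have "bump r (vec_lambda c *v x) = bump r x" for x
    by (rule bump_norm_cong)
  moreover have "det (vec_lambda c) = sgn (det A)"
    using det_orthogonal_matrix[OF om] c(1) by auto
  ultimately have "integral UNIV (\<lambda>x. bump r (A *v x) * det A) = sgn (det A) * integral UNIV (bump r :: real^'k \<Rightarrow> real)"
    using c(4) by (simp add: mult.commute)
  \<comment> \<open>The constant path at \<open>A\<close> serves to remove the shift
    \<open>a\<close>.\<close>
  moreover have "(1 - t) *\<^sub>R A + t *\<^sub>R A = A" for t :: real
    by (simp add: algebra_simps)
  ultimately show ?thesis
    using integral_bump_matrix_path[of A A r a] A r by simp
qed

section \<open>The integral as a sum over zeros\<close>

lemma integrable_zero_extension: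
  fixes h :: "'a::euclidean_space \<Rightarrow> 'b::euclidean_space"
  assumes "open U" "compact S" "S \<subseteq> U" "continuous_on U h" "\<And>x. x \<in> U - S \<Longrightarrow> h x = 0"
  shows "(\<lambda>x. if x \<in> U then h x else 0) integrable_on UNIV"
proof -
  let ?f = "\<lambda>x. if x \<in> U then h x else 0"
  have "continuous_on (U \<union> - S) ?f"
  proof (rule continuous_on_open_Un)
    show "continuous_on U ?f" by (rule continuous_on_eq[OF assms(4)]) auto
    show "continuous_on (- S) ?f"
      by (rule continuous_on_eq[of _ "\<lambda>_. 0"]) (use assms(5) in auto)
  qed (use assms(1,2) in \<open>auto simp: compact_imp_closed\<close>)
  moreover have "U \<union> - S = UNIV" using assms(3) by auto
  ultimately have cont: "continuous_on X ?f" for X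
    by (metis continuous_on_subset subset_UNIV)
  obtain c where "S \<subseteq> cbox (-c) c"
    using bounded_subset_cbox_symmetric[OF compact_imp_bounded[OF assms(2)]] by blast
  then show ?thesis
    using assms(5) by (intro integrable_on_superset[OF integrable_continuous[OF cont, of "-c" c]]) auto
qed

text \<open>The error tolerance is half of the lower bound \<open>m\<close> of the linear part, so
  every convex combination of \<open>f\<close> and its linearization keeps at least half of that
  bound.\<close>

lemma norm_bounded_below_near_zero:
  fixes f :: "real^'k \<Rightarrow> real^'k"
  assumes der: "(f has_derivative (*v) A) (at z)" and A: "det A \<noteq> 0" and fz: "f z = 0"
  obtains m \<delta> where "m > 0" "\<delta> > 0" "\<And>v. m * norm v \<le> norm (A *v v)"
    "\<And>x. dist z x < \<delta> \<Longrightarrow> norm (f x - A *v (x - z)) \<le> m / 2 * norm (x - z)"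
proof -
  obtain m where m: "m > 0" "\<And>v. m * norm v \<le> norm (A *v v)"
    using matrix_bounded_below[OF A] by blast
  obtain \<delta> where \<delta>: "\<delta> > 0"
      "\<And>x. norm (x - z) < \<delta> \<Longrightarrow> norm (f x - f z - A *v (x - z)) \<le> m / 2 * norm (x - z)"
    using der m(1) unfolding has_derivative_at_alt by (meson half_gt_zero)
  show ?thesis
    by (rule that[OF m(1) \<delta>(1) m(2)]) (use \<delta>(2) fz in \<open>auto simp: dist_norm norm_minus_commute\<close>)
qed

text \<open>The ball radius comes before the bump radius: the balls around different zeros must
  first be shrunk until they are disjoint, and how small the bump has to be depends on the
  balls.\<close>

lemma local_integral_bump:
  fixes f :: "real^'k \<Rightarrow> real^'k"
  assumes f: "c2_map U f p q" and z: "z \<in> U" "f z = 0"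
    and der: "(f has_derivative (*v) A) (at z)" and A: "det A \<noteq> 0"
  shows "\<exists>d>0. \<forall>\<delta>. 0 < \<delta> \<and> \<delta> \<le> d \<longrightarrow> (\<exists>\<rho>>0. \<forall>r. 0 < r \<and> r \<le> \<rho> \<longrightarrow>
      ball z \<delta> \<subseteq> U \<and>
      (\<lambda>x. if x \<in> ball z \<delta> then bump r (f x) * det (\<chi> j. p j x) else 0) integrable_on UNIV \<and>
      integral UNIV (\<lambda>x. if x \<in> ball z \<delta> then bump r (f x) * det (\<chi> j. p j x) else 0) =
      sgn (det A) * integral UNIV (bump r :: real^'k \<Rightarrow> real))"
    (is "\<exists>d>0. \<forall>\<delta>. _ \<longrightarrow> ?P \<delta>")
proof -
  interpret c2_map U f p q by fact
  obtain m d1 where m: "m > 0" "d1 > 0" "\<And>v. m * norm v \<le> norm (A *v v)"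
    "\<And>x. dist z x < d1 \<Longrightarrow> norm (f x - A *v (x - z)) \<le> m / 2 * norm (x - z)"
    by (rule norm_bounded_below_near_zero[OF der A z(2)]) (rule that; assumption)
  obtain d2 where d2: "d2 > 0" "ball z d2 \<subseteq> U"
    using open_U z(1) open_contains_ball by blast
  have "\<forall>\<delta>. 0 < \<delta> \<and> \<delta> \<le> min d1 d2 \<longrightarrow> ?P \<delta>"
  proof (intro allI impI)
    fix \<delta> assume "0 < \<delta> \<and> \<delta> \<le> min d1 d2"
    then have \<delta>: "0 < \<delta>" "\<delta> \<le> min d1 d2" by auto
    let ?B = "ball z \<delta>" and ?S = "cball z (\<delta> / 2)"
    have BU: "?B \<subseteq> U" and SB: "?S \<subseteq> ?B" using d2 \<delta> by auto
    have fB: "c2_map ?B f p q" by (rule c2_map_subset[OF f]) (use BU in auto)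
    \<comment> \<open>On this shell the distance to \<open>z\<close> is more than
      \<open>\<delta> / 2\<close>, and half of \<open>m\<close> survives the linearization error:
      m/2 times \<delta>/2.\<close>
    have away: "m * \<delta> / 4 \<le> norm ((1 - t) *\<^sub>R f x + t *\<^sub>R (A *v (x - z)))"
      if x: "x \<in> ?B - ?S" and t: "t \<in> {0..1}" for x t
    proof -
      have "norm (A *v (x - z)) \<le> norm ((1 - t) *\<^sub>R f x + t *\<^sub>R (A *v (x - z))) + norm ((1 - t) *\<^sub>R (f x - A *v (x - z)))"
        using norm_triangle_ineq4[of "(1 - t) *\<^sub>R f x + t *\<^sub>R (A *v (x - z))" "(1 - t) *\<^sub>R (f x - A *v (x - z))"]
        by (simp add: algebra_simps)
      moreover have "norm ((1 - t) *\<^sub>R (f x - A *v (x - z))) \<le> norm (f x - A *v (x - z))"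
        using t by (auto intro!: mult_left_le_one_le)
      moreover have "norm (f x - A *v (x - z)) \<le> m / 2 * norm (x - z)"
        using m(4)[of x] x \<delta> by auto
      moreover have "m / 2 * (\<delta> / 2) \<le> m / 2 * norm (x - z)"
        using x m(1) by (intro mult_left_mono) (auto simp: dist_norm norm_minus_commute)
      moreover have "m * norm (x - z) \<le> norm (A *v (x - z))" by (rule m(3))
      ultimately show ?thesis by linarith
    qed
    show "?P \<delta>"
    proof (intro exI[of _ "m * \<delta> / 4"] conjI allI impI)
      show "m * \<delta> / 4 > 0" using m(1) \<delta>(1) by simp
      show "?B \<subseteq> U" by (rule BU)
    next
      fix r assume r: "0 < r \<and> r \<le> m * \<delta> / 4"
      have "r \<le> norm (f x)" if "x \<in> ?B - ?S" for x
        using away[OF that, of 0] r by simp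
      then have "bump r (f x) = 0" if "x \<in> ?B - ?S" for x
        using that r by (intro bump_eq_0) auto
      moreover have "continuous_on ?B (\<lambda>x. bump r (f x) * det (\<chi> j. p j x))"
        by (intro continuous_intros continuous_on_det_rows c2_map.cont_f[OF fB] c2_map.cont_p[OF fB])
      ultimately show "(\<lambda>x. if x \<in> ?B then bump r (f x) * det (\<chi> j. p j x) else 0) integrable_on UNIV"
        by (intro integrable_zero_extension[OF open_ball compact_cball SB]) auto
      have away_r: "r \<le> norm ((1 - t) *\<^sub>R f x + t *\<^sub>R (A *v (x - z)))"
        if "x \<in> ?B - ?S" "t \<in> {0..1}" for x t
        using away[OF that] r by linarith
      have "integral UNIV (\<lambda>x. if x \<in> ?B then bump r (f x) * det (\<chi> j. p j x) else 0) =
          integral UNIV (\<lambda>x. if x \<in> ?B then bump r (A *v (x - z)) * det (\<chi> j. column j A) else 0)"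
        by (rule integral_bump_det_straight_line[OF fB c2_map_affine[OF open_ball] compact_cball SB _ away_r])
          (use r in auto)
      \<comment> \<open>Outside the ball the linearization has norm at least \<open>r\<close>, so
        the local integrand is already the global one and \<open>integral_bump_affine\<close>
        applies.\<close>
      also have "(\<lambda>x. if x \<in> ?B then bump r (A *v (x - z)) * det (\<chi> j. column j A) else 0) =
          (\<lambda>x. bump r (A *v (x - z)) * det A)"
      proof
        fix x
        have "bump r (A *v (x - z)) = 0" if "x \<notin> ?B"
        proof (rule bump_eq_0)
          have "m * \<delta> \<le> m * norm (x - z)"
            using that m(1) by (simp add: dist_norm norm_minus_commute)
          also have "\<dots> \<le> norm (A *v (x - z))" by (rule m(3))
          finally show "r \<le> norm (A *v (x - z))"
            using r mult_pos_pos[OF m(1) \<delta>(1)] by linarith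
        qed (use r in simp)
        then show "(if x \<in> ?B then bump r (A *v (x - z)) * det (\<chi> j. column j A) else 0) =
            bump r (A *v (x - z)) * det A"
          by (simp only: det_columns) simp
      qed
      also have "integral UNIV \<dots> = sgn (det A) * integral UNIV (bump r :: real^'k \<Rightarrow> real)"
        by (rule integral_bump_affine[OF A]) (use r in blast)
      finally show "integral UNIV (\<lambda>x. if x \<in> ?B then bump r (f x) * det (\<chi> j. p j x) else 0) =
        sgn (det A) * integral UNIV (bump r :: real^'k \<Rightarrow> real)" .
    qed
  qed
  moreover have "min d1 d2 > 0" using m(2) d2(1) by simp
  ultimately show ?thesis
    by (intro exI[of _ "min d1 d2"] conjI)
qed

lemma finite_separated:
  fixes Z :: "'a::metric_space set"
  assumes "finite Z"
  obtains d where "d > 0" "\<And>x y. x \<in> Z \<Longrightarrow> y \<in> Z \<Longrightarrow> x \<noteq> y \<Longrightarrow> d \<le> dist x y"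
proof -
  have "\<exists>d>0. \<forall>x\<in>Z. \<forall>y\<in>Z. x \<noteq> y \<longrightarrow> d \<le> dist x y"
    using assms
  proof (induction Z)
    case (insert a Z)
    then obtain d where d: "d > 0" "\<forall>x\<in>Z. \<forall>y\<in>Z. x \<noteq> y \<longrightarrow> d \<le> dist x y" by blast
    obtain e where e: "e > 0" "\<forall>x\<in>Z. x \<noteq> a \<longrightarrow> e \<le> dist a x"
      using finite_set_avoid[OF insert.hyps(1)] by blast
    show ?case
      by (rule exI[of _ "min d e"]) (use d e in \<open>auto simp: dist_commute intro: min.coboundedI1 min.coboundedI2\<close>)
  qed (auto intro: exI[of _ 1])
  then show ?thesis using that by blast
qed

text \<open>The condition "for all sufficiently small radii" survives finite intersections. It is
  applied twice, to the radii of the balls and then to those of the bump.\<close>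

lemma finite_uniform_pos:
  fixes P :: "'a \<Rightarrow> real \<Rightarrow> bool"
  assumes "finite Z" "\<And>z. z \<in> Z \<Longrightarrow> \<exists>\<rho>>0. \<forall>r. 0 < r \<and> r \<le> \<rho> \<longrightarrow> P z r"
  shows "\<exists>\<rho>>0. \<forall>r. 0 < r \<and> r \<le> \<rho> \<longrightarrow> (\<forall>z\<in>Z. P z r)"
  using assms
proof (induction Z)
  case (insert a Z)
  then obtain \<rho> where \<rho>: "\<rho> > 0" "\<forall>r. 0 < r \<and> r \<le> \<rho> \<longrightarrow> (\<forall>z\<in>Z. P z r)" by blast
  obtain \<sigma> where \<sigma>: "\<sigma> > 0" "\<forall>r. 0 < r \<and> r \<le> \<sigma> \<longrightarrow> P a r" using insert.prems by blast
  show ?case by (rule exI[of _ "min \<rho> \<sigma>"]) (use \<rho> \<sigma> in auto)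
qed (auto intro: exI[of _ 1])

text \<open>Away from small balls around the zeros the norm of \<open>f\<close> is bounded below, so
  a small bump sees only these balls, each of which contributes the sign of its determinant.\<close>

lemma integral_bump_det_eq_sum_zeros:
  fixes f :: "real^'k \<Rightarrow> real^'k"
  assumes f: "c2_map U f p q"
    and cont: "continuous_on (closure U) f"
    and cpt: "compact {x \<in> closure U. norm (f x) \<le> 1}"
    and bd: "\<And>x. x \<in> frontier U \<Longrightarrow> f x \<noteq> 0"
    and fin: "finite {x \<in> U. f x = 0}"
    and der: "\<And>z. z \<in> U \<Longrightarrow> f z = 0 \<Longrightarrow> (f has_derivative (*v) (A z)) (at z)"
    and det: "\<And>z. z \<in> U \<Longrightarrow> f z = 0 \<Longrightarrow> det (A z) \<noteq> 0"
  shows "\<exists>\<rho>>0. \<forall>r. 0 < r \<and> r \<le> \<rho> \<longrightarrow>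
    integral UNIV (\<lambda>x. if x \<in> U then bump r (f x) * det (\<chi> j. p j x) else 0) =
    (\<Sum>z | z \<in> U \<and> f z = 0. sgn (det (A z))) * integral UNIV (bump r :: real^'k \<Rightarrow> real)"
proof -
  interpret c2_map U f p q by fact
  define Z where "Z = {x \<in> U. f x = 0}"
  have finZ: "finite Z" using fin by (simp add: Z_def)
  define h where "h r x = bump r (f x) * det (\<chi> j. p j x)" for r x
  define L where "L \<delta> z r \<longleftrightarrow> ball z \<delta> \<subseteq> U \<and>
      (\<lambda>x. if x \<in> ball z \<delta> then h r x else 0) integrable_on UNIV \<and>
      integral UNIV (\<lambda>x. if x \<in> ball z \<delta> then h r x else 0) =
      sgn (det (A z)) * integral UNIV (bump r :: real^'k \<Rightarrow> real)" for \<delta> z r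
  have "\<exists>d>0. \<forall>\<delta>. 0 < \<delta> \<and> \<delta> \<le> d \<longrightarrow> (\<exists>\<rho>>0. \<forall>r. 0 < r \<and> r \<le> \<rho> \<longrightarrow> L \<delta> z r)"
    if "z \<in> Z" for z
  proof -
    have z: "z \<in> U" "f z = 0" using that by (auto simp: Z_def)
    show ?thesis
      unfolding L_def h_def by (rule local_integral_bump[OF f z der[OF z] det[OF z]])
  qed
  from finite_uniform_pos[OF finZ, of "\<lambda>z \<delta>. \<exists>\<rho>>0. \<forall>r. 0 < r \<and> r \<le> \<rho> \<longrightarrow> L \<delta> z r", OF this]
  obtain d where d: "d > 0"
    "\<And>\<delta> z. 0 < \<delta> \<Longrightarrow> \<delta> \<le> d \<Longrightarrow> z \<in> Z \<Longrightarrow> \<exists>\<rho>>0. \<forall>r. 0 < r \<and> r \<le> \<rho> \<longrightarrow> L \<delta> z r"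
    by blast
  obtain e where e: "e > 0" "\<And>x y. x \<in> Z \<Longrightarrow> y \<in> Z \<Longrightarrow> x \<noteq> y \<Longrightarrow> e \<le> dist x y"
    using finite_separated[OF finZ] by blast
  \<comment> \<open>Half the minimal separation of zeros makes the balls disjoint.\<close>
  define \<delta> where "\<delta> = min d (e / 2)"
  have \<delta>: "\<delta> > 0" "\<delta> \<le> d" using d e by (auto simp: \<delta>_def)
  have disj: "x = y" if "x \<in> Z" "y \<in> Z" "w \<in> ball x \<delta>" "w \<in> ball y \<delta>" for x y w
  proof (rule ccontr)
    assume "x \<noteq> y"
    then have "e \<le> dist x y" using e(2) that by blast
    also have "\<dots> \<le> dist x w + dist y w" by (rule dist_triangle2)
    also have "\<dots> < e" using that by (auto simp: \<delta>_def)
    finally show False by simp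
  qed
  obtain \<rho>1 where \<rho>1: "\<rho>1 > 0" "\<And>r z. 0 < r \<Longrightarrow> r \<le> \<rho>1 \<Longrightarrow> z \<in> Z \<Longrightarrow> L \<delta> z r"
    using finite_uniform_pos[OF finZ, of "L \<delta>", OF d(2)[OF \<delta>]] by blast
  \<comment> \<open>The closure of \<open>U\<close> is used so that this set is compact;
    \<open>bd\<close> rules out zeros on the added frontier points.\<close>
  define K where "K = {x \<in> closure U. norm (f x) \<le> 1} - (\<Union>z\<in>Z. ball z \<delta>)"
  have "compact K"
    unfolding K_def by (intro compact_diff cpt) auto
  have nz: "f x \<noteq> 0" if "x \<in> K" for x
  proof
    assume "f x = 0"
    then have "x \<in> U" using that bd[of x] open_U by (auto simp: K_def frontier_def interior_open)
    then show False using that \<open>f x = 0\<close> \<delta>(1) by (auto simp: K_def Z_def)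
  qed
  obtain \<rho>2 where \<rho>2: "\<rho>2 > 0" "\<And>x. x \<in> K \<Longrightarrow> \<rho>2 \<le> norm (f x)"
  proof (cases "K = {}")
    case False
    have "continuous_on K (\<lambda>x. norm (f x))"
      by (intro continuous_on_norm continuous_on_subset[OF cont]) (auto simp: K_def)
    from continuous_attains_inf[OF \<open>compact K\<close> False this] obtain y where
      "y \<in> K" "\<forall>x\<in>K. norm (f y) \<le> norm (f x)" by blast
    then show ?thesis using nz that[of "norm (f y)"] by auto
  qed (use that[of 1] in auto)
  show ?thesis
  \<comment> \<open>The bound 1 handles points outside \<open>K\<close> with
    \<open>norm (f x) > 1\<close>, where the bump vanishes as well.\<close>
  proof (intro exI[of _ "min 1 (min \<rho>1 \<rho>2)"] conjI allI impI)
    show "min 1 (min \<rho>1 \<rho>2) > 0" using \<rho>1 \<rho>2 by auto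
    fix r assume r: "0 < r \<and> r \<le> min 1 (min \<rho>1 \<rho>2)"
    then have L: "L \<delta> z r" if "z \<in> Z" for z using \<rho>1(2) that by auto
    have h0: "h r x = 0" if x: "x \<in> U" "x \<notin> (\<Union>z\<in>Z. ball z \<delta>)" for x
    proof -
      have "r \<le> norm (f x)"
        using r \<rho>2(2)[of x] x closure_subset[of U] by (cases "norm (f x) \<le> 1") (auto simp: K_def)
      then show ?thesis using r by (simp add: h_def bump_eq_0)
    qed
    have "(if x \<in> U then h r x else 0) = (\<Sum>z\<in>Z. if x \<in> ball z \<delta> then h r x else 0)" for x
    proof (cases "\<exists>z\<in>Z. x \<in> ball z \<delta>")
      case True
      then obtain z where z: "z \<in> Z" "x \<in> ball z \<delta>" by blast
      have "(\<Sum>z\<in>Z. if x \<in> ball z \<delta> then h r x else 0) = (\<Sum>y\<in>Z. if y = z then h r x else 0)"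
        using disj z by (intro sum.cong) auto
      moreover have "x \<in> U" using L[OF z(1)] z(2) by (auto simp: L_def)
      ultimately show ?thesis using z finZ by simp
    next
      case False
      then have "(\<Sum>z\<in>Z. if x \<in> ball z \<delta> then h r x else 0) = 0"
        by (intro sum.neutral) auto
      then show ?thesis using h0 False by auto
    qed
    then have "integral UNIV (\<lambda>x. if x \<in> U then h r x else 0) =
        integral UNIV (\<lambda>x. \<Sum>z\<in>Z. if x \<in> ball z \<delta> then h r x else 0)"
      by (intro arg_cong[where f = "integral UNIV"] ext)
    also have "\<dots> = (\<Sum>z\<in>Z. integral UNIV (\<lambda>x. if x \<in> ball z \<delta> then h r x else 0))"
      using L by (intro integral_sum finZ) (auto simp: L_def)
    also have "\<dots> = (\<Sum>z\<in>Z. sgn (det (A z))) * integral UNIV (bump r :: real^'k \<Rightarrow> real)"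
      using L by (simp add: L_def sum_distrib_right)
    finally show "integral UNIV (\<lambda>x. if x \<in> U then bump r (f x) * det (\<chi> j. p j x) else 0) =
      (\<Sum>z | z \<in> U \<and> f z = 0. sgn (det (A z))) * integral UNIV (bump r :: real^'k \<Rightarrow> real)"
      unfolding Z_def h_def .
  qed
qed

section \<open>Symmetry of second derivatives\<close>

lemma has_vector_derivative_along_line:
  assumes "f differentiable (at x)"
  shows "((\<lambda>s. f (x + s *\<^sub>R v)) has_vector_derivative frechet_derivative f (at x) v) (at 0)"
proof -
  let ?D = "frechet_derivative f (at x)"
  have D: "(f has_derivative ?D) (at x)" using assms by (rule frechet_derivative_works[THEN iffD1])
  have "((\<lambda>s. x + s *\<^sub>R v) has_derivative (\<lambda>s. s *\<^sub>R v)) (at 0)"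
    by (auto intro!: derivative_eq_intros)
  from has_derivative_compose[OF this, of f ?D] D
  have "((\<lambda>s. f (x + s *\<^sub>R v)) has_derivative (\<lambda>s. ?D (s *\<^sub>R v))) (at 0)" by simp
  then show ?thesis
    unfolding has_vector_derivative_def
    by (simp add: linear_cmul[OF has_derivative_linear[OF D]])
qed

text \<open>The mean value theorem is applied twice: to the difference of \<open>F\<close> on two
  parallel segments in direction \<open>v\<close>, then to \<open>F'\<close> in direction
  \<open>w\<close>.\<close>

lemma second_difference_mean_value:
  fixes F F' F'' :: "'a::real_normed_vector \<Rightarrow> real"
  assumes e: "e > 0"
    and F: "\<And>x. x \<in> V \<Longrightarrow> ((\<lambda>s. F (x + s *\<^sub>R v)) has_real_derivative F' x) (at 0)"
    and F': "\<And>x. x \<in> V \<Longrightarrow> ((\<lambda>s. F' (x + s *\<^sub>R w)) has_real_derivative F'' x) (at 0)"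
    and V: "\<And>s t. s \<in> {0..e} \<Longrightarrow> t \<in> {0..e} \<Longrightarrow> z + s *\<^sub>R v + t *\<^sub>R w \<in> V"
  obtains s t where "s \<in> {0..e}" "t \<in> {0..e}"
    "F (z + e *\<^sub>R v + e *\<^sub>R w) - F (z + e *\<^sub>R v) - F (z + e *\<^sub>R w) + F z = e * e * F'' (z + s *\<^sub>R v + t *\<^sub>R w)"
proof -
  have line: "((\<lambda>s. f (x + s *\<^sub>R u)) has_real_derivative f' (x + s *\<^sub>R u)) (at s)"
    if "\<And>x. x \<in> V \<Longrightarrow> ((\<lambda>s. f (x + s *\<^sub>R u)) has_real_derivative f' x) (at 0)" "x + s *\<^sub>R u \<in> V"
    for f f' :: "'a \<Rightarrow> real" and x u s
  proof -
    have "((\<lambda>t. f ((x + s *\<^sub>R u) + t *\<^sub>R u)) has_real_derivative f' (x + s *\<^sub>R u)) (at 0)"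
      by (rule that)+
    then have "((\<lambda>t. f (x + (t + s) *\<^sub>R u)) has_real_derivative f' (x + s *\<^sub>R u)) (at 0)"
      by (simp add: algebra_simps)
    then show ?thesis
      using DERIV_shift[of "\<lambda>t. f (x + t *\<^sub>R u)" "f' (x + s *\<^sub>R u)" 0 s] by simp
  qed
  have "((\<lambda>s. F ((z + e *\<^sub>R w) + s *\<^sub>R v) - F (z + s *\<^sub>R v)) has_real_derivative
      F' ((z + e *\<^sub>R w) + s *\<^sub>R v) - F' (z + s *\<^sub>R v)) (at s)" if "0 \<le> s" "s \<le> e" for s
    using V[of s e] V[of s 0] that e
    by (intro DERIV_diff; intro line[where f = F and f' = F'] F) (auto simp: add_ac)
  from MVT2[OF e this] obtain s where s: "0 < s" "s < e"
    "F (z + e *\<^sub>R w + e *\<^sub>R v) - F (z + e *\<^sub>R v) - (F (z + e *\<^sub>R w) - F z) =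
     e * (F' (z + e *\<^sub>R w + s *\<^sub>R v) - F' (z + s *\<^sub>R v))"
    by auto
  have "((\<lambda>t. F' (z + s *\<^sub>R v + t *\<^sub>R w)) has_real_derivative F'' (z + s *\<^sub>R v + t *\<^sub>R w)) (at t)"
    if "0 \<le> t" "t \<le> e" for t
    using V[of s t] that s by (intro line[where f = F' and f' = F''] F') auto
  from MVT2[OF e this] obtain t where t: "0 < t" "t < e"
    "F' (z + s *\<^sub>R v + e *\<^sub>R w) - F' (z + s *\<^sub>R v) = e * F'' (z + s *\<^sub>R v + t *\<^sub>R w)"
    by auto
  show ?thesis
    by (rule that[of s t]) (use s t in \<open>auto simp: algebra_simps\<close>)
qed

text \<open>Schwarz's theorem: the second difference is symmetric in \<open>v\<close> and
  \<open>w\<close>, so both iterated derivatives take equal values at points arbitrarily close to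
  \<open>z\<close>, and continuity forces equality at \<open>z\<close>.\<close>

lemma second_directional_derivatives_commute:
  fixes F Fv Fw Fvw Fwv :: "'a::real_normed_vector \<Rightarrow> real"
  assumes V: "open V" "z \<in> V"
    and Fv: "\<And>x. x \<in> V \<Longrightarrow> ((\<lambda>s. F (x + s *\<^sub>R v)) has_real_derivative Fv x) (at 0)"
    and Fvw: "\<And>x. x \<in> V \<Longrightarrow> ((\<lambda>s. Fv (x + s *\<^sub>R w)) has_real_derivative Fvw x) (at 0)"
    and Fw: "\<And>x. x \<in> V \<Longrightarrow> ((\<lambda>s. F (x + s *\<^sub>R w)) has_real_derivative Fw x) (at 0)"
    and Fwv: "\<And>x. x \<in> V \<Longrightarrow> ((\<lambda>s. Fw (x + s *\<^sub>R v)) has_real_derivative Fwv x) (at 0)"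
    and cont: "continuous_on V Fvw" "continuous_on V Fwv"
  shows "Fvw z = Fwv z"
proof (rule ccontr)
  assume ne: "Fvw z \<noteq> Fwv z"
  \<comment> \<open>Two values within half the gap of \<open>Fvw z\<close> and \<open>Fwv z\<close>
    respectively cannot coincide.\<close>
  define \<epsilon> where "\<epsilon> = \<bar>Fvw z - Fwv z\<bar> / 2"
  have "\<epsilon> > 0" using ne by (simp add: \<epsilon>_def)
  have "isCont Fvw z" "isCont Fwv z" using cont V by (auto simp: continuous_on_eq_continuous_at)
  then obtain d1 d2 where d: "d1 > 0" "\<And>x. dist x z < d1 \<Longrightarrow> \<bar>Fvw x - Fvw z\<bar> < \<epsilon>"
      "d2 > 0" "\<And>x. dist x z < d2 \<Longrightarrow> \<bar>Fwv x - Fwv z\<bar> < \<epsilon>"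
    using \<open>\<epsilon> > 0\<close> unfolding continuous_at_eps_delta dist_real_def by metis
  obtain d3 where d3: "d3 > 0" "ball z d3 \<subseteq> V" using V open_contains_ball by blast
  define \<delta> where "\<delta> = min d1 (min d2 d3)"
  \<comment> \<open>This scale keeps the whole parallelogram within \<delta> of \<open>z\<close>;
    the summand 1 keeps the denominator positive and the estimate strict.\<close>
  define e where "e = \<delta> / (norm v + norm w + 1)"
  have pos: "norm v + norm w + 1 > 0" using norm_ge_zero[of v] norm_ge_zero[of w] by linarith
  have "\<delta> > 0" using d d3 by (simp add: \<delta>_def)
  then have e: "e > 0" using pos by (simp add: e_def)
  have near: "dist (z + s *\<^sub>R v + t *\<^sub>R w) z < \<delta>" if "s \<in> {0..e}" "t \<in> {0..e}" for s t
  proof -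
    have "norm (s *\<^sub>R v + t *\<^sub>R w) \<le> s * norm v + t * norm w"
      using norm_triangle_ineq[of "s *\<^sub>R v" "t *\<^sub>R w"] that by simp
    also have "\<dots> \<le> e * norm v + e * norm w"
      using that by (intro add_mono mult_right_mono) auto
    also have "\<dots> < e * (norm v + norm w + 1)" using e by (simp add: algebra_simps)
    also have "\<dots> = \<delta>" using pos by (simp add: e_def)
    finally show ?thesis by (simp add: dist_norm add.assoc)
  qed
  have inV: "x \<in> V" if "dist x z < \<delta>" for x
    using that d3(2) by (auto simp: \<delta>_def dist_commute)
  obtain s t where st: "s \<in> {0..e}" "t \<in> {0..e}"
    "F (z + e *\<^sub>R v + e *\<^sub>R w) - F (z + e *\<^sub>R v) - F (z + e *\<^sub>R w) + F z = e * e * Fvw (z + s *\<^sub>R v + t *\<^sub>R w)"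
    by (rule second_difference_mean_value[OF e Fv Fvw, where z = z]) (use near inV in blast)+
  obtain s' t' where st': "s' \<in> {0..e}" "t' \<in> {0..e}"
    "F (z + e *\<^sub>R w + e *\<^sub>R v) - F (z + e *\<^sub>R w) - F (z + e *\<^sub>R v) + F z = e * e * Fwv (z + s' *\<^sub>R w + t' *\<^sub>R v)"
  proof (rule second_difference_mean_value[OF e Fw Fwv, where z = z])
    show "z + s *\<^sub>R w + t *\<^sub>R v \<in> V" if "s \<in> {0..e}" "t \<in> {0..e}" for s t
      using inV[OF near[OF that(2,1)]] by (simp add: algebra_simps)
  qed
  have "e * e * Fvw (z + s *\<^sub>R v + t *\<^sub>R w) = e * e * Fwv (z + s' *\<^sub>R w + t' *\<^sub>R v)"
    using st(3) st'(3) by (simp add: algebra_simps)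
  then have "Fvw (z + s *\<^sub>R v + t *\<^sub>R w) = Fwv (z + t' *\<^sub>R v + s' *\<^sub>R w)"
    using e by (simp add: algebra_simps)
  moreover have "\<bar>Fvw (z + s *\<^sub>R v + t *\<^sub>R w) - Fvw z\<bar> < \<epsilon>"
    using near[OF st(1,2)] by (intro d(2)) (simp add: \<delta>_def)
  moreover have "\<bar>Fwv (z + t' *\<^sub>R v + s' *\<^sub>R w) - Fwv z\<bar> < \<epsilon>"
    using near[OF st'(2,1)] by (intro d(4)) (simp add: \<delta>_def)
  ultimately show False by (simp add: \<epsilon>_def abs_if split: if_splits)
qed

lemma Ck_on_Suc_continuous_on: "Ck_on (Suc n) f S \<Longrightarrow> continuous_on S f"
  by (intro continuous_at_imp_continuous_on ballI differentiable_imp_continuous_within) simp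

text \<open>The argument runs through coordinates because the mean value theorem behind it is for
  real-valued functions.\<close>

lemma frechet_derivative_commute:
  fixes h :: "'a::euclidean_space \<Rightarrow> 'b::euclidean_space"
  assumes V: "open V" "z \<in> V" and h: "Ck_on 2 h V"
  shows "frechet_derivative (\<lambda>x. frechet_derivative h (at x) v) (at z) w =
         frechet_derivative (\<lambda>x. frechet_derivative h (at x) w) (at z) v"
proof (rule euclidean_eqI)
  fix b :: 'b assume "b \<in> Basis"
  have h1: "Ck_on (Suc 0) (\<lambda>x. frechet_derivative h (at x) u) V" for u
    using h by (simp add: numeral_2_eq_2)
  have along: "((\<lambda>s. g (x + s *\<^sub>R u) \<bullet> b) has_real_derivative frechet_derivative g (at x) u \<bullet> b) (at 0)"
    if "g differentiable (at x)" for g :: "'a \<Rightarrow> 'b" and x u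
    unfolding has_real_derivative_iff_has_vector_derivative
    by (intro bounded_linear.has_vector_derivative[OF bounded_linear_inner_left]
        has_vector_derivative_along_line that)
  have dh: "h differentiable (at x)" if "x \<in> V" for x
    using h that by (simp add: numeral_2_eq_2)
  have ddh: "(\<lambda>x. frechet_derivative h (at x) u) differentiable (at x)" if "x \<in> V" for x u
    using h1 that by simp
  have cddh: "continuous_on V (\<lambda>x. frechet_derivative (\<lambda>x. frechet_derivative h (at x) u) (at x) u' \<bullet> b)" for u u'
    using h1 by (intro continuous_on_inner continuous_on_const) simp
  show "frechet_derivative (\<lambda>x. frechet_derivative h (at x) v) (at z) w \<bullet> b =
        frechet_derivative (\<lambda>x. frechet_derivative h (at x) w) (at z) v \<bullet> b"
    by (rule second_directional_derivatives_commute[where F = "\<lambda>x. h x \<bullet> b"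
        and Fv = "\<lambda>x. frechet_derivative h (at x) v \<bullet> b"
        and Fw = "\<lambda>x. frechet_derivative h (at x) w \<bullet> b"
        and Fvw = "\<lambda>y. frechet_derivative (\<lambda>x. frechet_derivative h (at x) v) (at y) w \<bullet> b"
        and Fwv = "\<lambda>y. frechet_derivative (\<lambda>x. frechet_derivative h (at x) w) (at y) v \<bullet> b"
        and v = v and w = w, OF V])
      (assumption | rule along[where g = h] along[where g = "\<lambda>x. frechet_derivative h (at x) u" for u] dh ddh cddh)+
qed

section \<open>Partial derivatives of a smooth homotopy\<close>

lemma has_vector_derivative_frechet:
  fixes f :: "real \<Rightarrow> 'a::real_normed_vector"
  assumes "f differentiable (at t)"
  shows "(f has_vector_derivative frechet_derivative f (at t) 1) (at t)"
proof -
  let ?D = "frechet_derivative f (at t)"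
  have "(f has_derivative ?D) (at t)" using assms by (rule frechet_derivative_works[THEN iffD1])
  moreover have "?D = (\<lambda>s. s *\<^sub>R ?D 1)"
  proof
    show "?D s = s *\<^sub>R ?D 1" for s
      using linear_cmul[OF linear_frechet_derivative[OF assms], of s 1] by simp
  qed
  ultimately show ?thesis
    unfolding has_vector_derivative_def by (simp only:)
qed

lemma has_vector_derivative_snd:
  fixes f :: "'a::real_normed_vector \<times> real \<Rightarrow> 'b::real_normed_vector"
  assumes "f differentiable (at (x, t))"
  shows "((\<lambda>s. f (x, s)) has_vector_derivative frechet_derivative f (at (x, t)) (0, 1)) (at t)"
proof -
  let ?D = "frechet_derivative f (at (x, t))"
  have D: "(f has_derivative ?D) (at (x, t))" using assms by (rule frechet_derivative_works[THEN iffD1])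
  have "((\<lambda>s. (x, s)) has_derivative (\<lambda>s. (0, s))) (at t)"
    by (auto intro!: derivative_eq_intros)
  from has_derivative_compose[OF this D]
  have "((\<lambda>s. f (x, s)) has_derivative (\<lambda>s. ?D (0, s))) (at t)" .
  moreover have "(\<lambda>s. ?D (0, s)) = (\<lambda>s. s *\<^sub>R ?D (0, 1))"
  proof
    show "?D (0, s) = s *\<^sub>R ?D (0, 1)" for s
      using linear_cmul[OF has_derivative_linear[OF D], of s "(0, 1)"] by simp
  qed
  ultimately show ?thesis
    unfolding has_vector_derivative_def by (simp only:)
qed

lemma has_vector_derivative_fst:
  fixes f :: "'a::real_normed_vector \<times> real \<Rightarrow> 'b::real_normed_vector"
  assumes "f differentiable (at (x, t))"
  shows "((\<lambda>s. f (x + s *\<^sub>R v, t)) has_vector_derivative frechet_derivative f (at (x, t)) (v, 0)) (at 0)"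
  using has_vector_derivative_along_line[OF assms, of "(v, 0)"] by simp

text \<open>Here \<open>h\<close> and \<open>a\<close> are extensions to open neighbourhoods: they
  have full derivatives at the times 0 and 1, while the given maps are unconstrained beyond
  \<open>{0..1}\<close>.\<close>

lemma smooth_homotopy_c2_homotopy:
  fixes h :: "(real^'k) \<times> real \<Rightarrow> real^'k" and a :: "real \<Rightarrow> real^'k"
  assumes U: "open U" and V: "open V" "U \<times> {0..1} \<subseteq> V" and h: "\<And>n. Ck_on n h V"
    and W: "open W" "{0..1} \<subseteq> W" and a: "\<And>n. Ck_on n a W"
  shows "c2_homotopy U (\<lambda>x t. h (x, t) - a t)
    (\<lambda>x t. frechet_derivative h (at (x, t)) (0, 1) - frechet_derivative a (at t) 1)
    (\<lambda>i x t. frechet_derivative h (at (x, t)) (axis i 1, 0))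
    (\<lambda>i x t. frechet_derivative (\<lambda>z. frechet_derivative h (at z) (axis i 1, 0)) (at (x, t)) (0, 1))
    (\<lambda>i j x t. frechet_derivative (\<lambda>z. frechet_derivative h (at z) (axis j 1, 0)) (at (x, t)) (axis i 1, 0))"
proof -
  have h2: "Ck_on (Suc (Suc 0)) h V" by (rule h)
  have dh: "h differentiable (at z)"
    and ddh: "(\<lambda>z. frechet_derivative h (at z) v) differentiable (at z)"
    if "z \<in> V" for z v
    using h2 that by (simp_all del: split_paired_All)
  have ch: "continuous_on V h" by (rule Ck_on_Suc_continuous_on[OF h2])
  have cdh: "continuous_on V (\<lambda>z. frechet_derivative h (at z) v)" for v
    using h2 by (intro Ck_on_Suc_continuous_on[of 0]) (simp del: split_paired_All)
  have cddh: "continuous_on V (\<lambda>z. frechet_derivative (\<lambda>z. frechet_derivative h (at z) v) (at z) w)" for v w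
    using h2 by (simp del: split_paired_All)
  have a1: "Ck_on (Suc 0) a W" by (rule a)
  have da: "a differentiable (at t)" if "t \<in> W" for t using a1 that by simp
  have ca: "continuous_on W a" "continuous_on W (\<lambda>t. frechet_derivative a (at t) 1)"
    using Ck_on_Suc_continuous_on[OF a1] a1 by simp_all
  have sym: "frechet_derivative (\<lambda>x. frechet_derivative h (at x) v) (at z) w =
      frechet_derivative (\<lambda>x. frechet_derivative h (at x) w) (at z) v" if "z \<in> V" for z v w
    by (rule frechet_derivative_commute[OF V(1) that h])
  have inV: "(x, t) \<in> V" if "x \<in> U" "t \<in> {0..1}" for x t using that V(2) by auto
  have inW: "t \<in> W" if "t \<in> {0..1}" for t using that W(2) by auto
  have fstc: "continuous_on (U \<times> {0..1}) (\<lambda>z. g (fst z, snd z))" if "continuous_on V g"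
    for g :: "(real^'k) \<times> real \<Rightarrow> real^'k"
    using continuous_on_subset[OF that V(2)] by simp
  have sndc: "continuous_on (U \<times> {0..1}) (\<lambda>z. g (snd z))" if "continuous_on W g"
    for g :: "real \<Rightarrow> real^'k"
    by (rule continuous_on_compose2[OF that continuous_on_snd[OF continuous_on_id]]) (use W(2) in auto)
  show ?thesis
  proof
    fix x :: "real^'k" and t :: real and i j :: 'k
    assume x: "x \<in> U" and t: "t \<in> {0..1}"
    note xt = inV[OF x t]
    show "((\<lambda>s. h (x + s *\<^sub>R axis i 1, t) - a t) has_vector_derivative
        frechet_derivative h (at (x, t)) (axis i 1, 0)) (at 0)"
      using has_vector_derivative_diff[OF has_vector_derivative_fst[OF dh[OF xt]] has_vector_derivative_const]
      by simp
    show "((\<lambda>t. h (x, t) - a t) has_vector_derivative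
        frechet_derivative h (at (x, t)) (0, 1) - frechet_derivative a (at t) 1) (at t within {0..1})"
      by (intro has_vector_derivative_diff has_vector_derivative_at_within[OF has_vector_derivative_snd[OF dh[OF xt]]]
          has_vector_derivative_at_within[OF has_vector_derivative_frechet[OF da[OF inW[OF t]]]])
    show "((\<lambda>s. frechet_derivative h (at (x + s *\<^sub>R axis i 1, t)) (axis j 1, 0)) has_vector_derivative
        frechet_derivative (\<lambda>z. frechet_derivative h (at z) (axis j 1, 0)) (at (x, t)) (axis i 1, 0)) (at 0)"
      by (rule has_vector_derivative_fst[OF ddh[OF xt]])
    show "((\<lambda>t. frechet_derivative h (at (x, t)) (axis j 1, 0)) has_vector_derivative
        frechet_derivative (\<lambda>z. frechet_derivative h (at z) (axis j 1, 0)) (at (x, t)) (0, 1)) (at t within {0..1})"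
      by (rule has_vector_derivative_at_within[OF has_vector_derivative_snd[OF ddh[OF xt]]])
    \<comment> \<open>The space derivative of the velocity yields the mixed derivative in the
      opposite order, hence the appeal to symmetry; the term in \<open>a\<close> is constant in
      space.\<close>
    show "((\<lambda>s. frechet_derivative h (at (x + s *\<^sub>R axis i 1, t)) (0, 1) - frechet_derivative a (at t) 1)
        has_vector_derivative
        frechet_derivative (\<lambda>z. frechet_derivative h (at z) (axis i 1, 0)) (at (x, t)) (0, 1)) (at 0)"
      using has_vector_derivative_diff[OF has_vector_derivative_fst[OF ddh[OF xt]] has_vector_derivative_const]
      unfolding sym[OF xt, of "(axis i 1, 0)" "(0, 1)"] by simp
    show "frechet_derivative (\<lambda>z. frechet_derivative h (at z) (axis j 1, 0)) (at (x, t)) (axis i 1, 0) =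
        frechet_derivative (\<lambda>z. frechet_derivative h (at z) (axis i 1, 0)) (at (x, t)) (axis j 1, 0)"
      by (rule sym[OF xt])
  qed (unfold case_prod_beta, (intro U continuous_on_diff fstc[OF ch] fstc[OF cdh] fstc[OF cddh]
      sndc[OF ca(1)] sndc[OF ca(2)])+)
qed

section \<open>The degree\<close>

lemma c2_homotopy_slice:
  assumes "c2_homotopy U G Q P T R" and t: "t \<in> {0..1}"
  shows "c2_map U (\<lambda>x. G x t) (\<lambda>i x. P i x t) (\<lambda>i j x. R i j x t)"
proof -
  interpret c2_homotopy U G Q P T R by fact
  have slice: "continuous_on U (\<lambda>x. g x t)" if "continuous_on (U \<times> {0..1}) (\<lambda>(x, t). g x t)"
    for g :: "real^'a \<Rightarrow> real \<Rightarrow> real^'a"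
  proof -
    have "continuous_on U (\<lambda>x. (x, t))" "(\<lambda>x. (x, t)) ` U \<subseteq> U \<times> {0..1}"
      using t by (auto intro: continuous_on_Pair)
    from continuous_on_compose2[OF that this] show ?thesis by simp
  qed
  show ?thesis
    by unfold_locales (intro open_U G_x[OF _ t] P_x[OF _ t] R_sym[OF _ t] slice[OF cont_G] slice[OF cont_P]
      slice[OF cont_R]; assumption)+
qed

lemma of_int_floor_sgn: "real_of_int \<lfloor>sgn x\<rfloor> = sgn (x::real)"
proof -
  have "\<lfloor>- 1::real\<rfloor> = - 1" by linarith
  then show ?thesis by (auto simp: sgn_if)
qed

text \<open>Two functions occur because the degree refers to the derivative of \<open>f\<close>,
  while the second-order data belong to the extension \<open>g\<close>. They differ by the constant
  \<open>y\<close> on the open set \<open>U\<close>, so their derivatives agree there.\<close>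

lemma deg_integral_formula:
  fixes f g :: "real^'k \<Rightarrow> real^'k"
  assumes R: "regular_triple f U y" and g: "c2_map U g p q"
    and eq: "\<And>x. x \<in> closure U \<Longrightarrow> g x = f x - y"
  shows "\<exists>\<rho>>0. \<forall>r. 0 < r \<and> r \<le> \<rho> \<longrightarrow>
    integral UNIV (\<lambda>x. if x \<in> U then bump r (g x) * det (\<chi> j. p j x) else 0) =
    real_of_int (deg f U y) * integral UNIV (bump r :: real^'k \<Rightarrow> real)"
proof -
  have adm: "admissible_triple f U y" and reg: "\<And>x. x \<in> f -` {y} \<inter> U \<Longrightarrow> det (jacobian f (at x)) \<noteq> 0"
    using R by (auto simp: regular_triple_def)
  have U: "open U" using adm by (simp add: admissible_triple_def)
  have sub: "x \<in> closure U" if "x \<in> U" for x using that closure_subset by blast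
  have zeros: "{x \<in> U. g x = 0} = f -` {y} \<inter> U" using eq sub by auto
  have "\<exists>\<rho>>0. \<forall>r. 0 < r \<and> r \<le> \<rho> \<longrightarrow>
    integral UNIV (\<lambda>x. if x \<in> U then bump r (g x) * det (\<chi> j. p j x) else 0) =
    (\<Sum>z | z \<in> U \<and> g z = 0. sgn (det (jacobian f (at z)))) * integral UNIV (bump r :: real^'k \<Rightarrow> real)"
  proof (rule integral_bump_det_eq_sum_zeros[OF g])
    have "continuous_on (closure U) (\<lambda>x. f x - y)"
      using adm by (intro continuous_intros) (simp add: admissible_triple_def)
    then show "continuous_on (closure U) g" by (rule continuous_on_eq) (simp add: eq)
    \<comment> \<open>Properness enters here, through the preimage of the unit ball around
      \<open>y\<close>.\<close>
    have "{x \<in> closure U. norm (g x) \<le> 1} = f -` cball y 1 \<inter> closure U"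
      using eq by (auto simp: dist_norm norm_minus_commute)
    then show "compact {x \<in> closure U. norm (g x) \<le> 1}"
      using adm by (simp add: admissible_triple_def proper_on_def)
    show "g x \<noteq> 0" if "x \<in> frontier U" for x
      using adm that eq[of x] by (auto simp: admissible_triple_def frontier_def)
    show "finite {x \<in> U. g x = 0}"
      unfolding zeros by (rule regular_triple_finite[OF R])
    fix z assume z: "z \<in> U" "g z = 0"
    have "(f has_derivative (*v) (jacobian f (at z))) (at z)"
      using regular_triple_differentiable[OF R z(1)] jacobian_works by blast
    then have "((\<lambda>x. f x - y) has_derivative (*v) (jacobian f (at z))) (at z)"
      using has_derivative_diff[OF _ has_derivative_const] by fastforce
    then show "(g has_derivative (*v) (jacobian f (at z))) (at z)"
      by (rule has_derivative_transform_within_open[OF _ U z(1)]) (simp add: eq sub)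
    show "det (jacobian f (at z)) \<noteq> 0" using reg zeros z by auto
  qed
  moreover have "(\<Sum>z | z \<in> U \<and> g z = 0. sgn (det (jacobian f (at z)))) = real_of_int (deg f U y)"
    unfolding deg_def zeros of_int_sum
    using regular_triple_differentiable[OF R]
    by (intro sum.cong) (auto simp: local_index_def of_int_floor_sgn)
  ultimately show ?thesis by (simp only:)
qed

text \<open>Properness makes the region where \<open>H\<close> is close to \<alpha> compact even for
  unbounded \<open>U\<close>. On its part over the frontier the distance to \<alpha> has a positive
  minimum, so smaller distances occur only over a compact subset of \<open>U\<close>.\<close>

lemma admissible_homotopy_compact_support:
  fixes H :: "(real^'k) \<times> real \<Rightarrow> real^'k"
  assumes adm: "admissible_homotopy H U \<alpha>"
  obtains S \<rho> where "compact S" "S \<subseteq> U" "\<rho> > 0"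
    "\<And>x t. x \<in> closure U - S \<Longrightarrow> t \<in> {0..1} \<Longrightarrow> \<rho> \<le> norm (H (x, t) - \<alpha> t)"
proof -
  have U: "open U" and cH: "continuous_on (closure U \<times> {0..1}) H" and c\<alpha>: "continuous_on {0..1} \<alpha>"
    and proper: "\<And>K. compact K \<Longrightarrow> compact (H -` K \<inter> closure U \<times> {0..1})"
    and bd: "\<And>x t. x \<in> frontier U \<Longrightarrow> t \<in> {0..1} \<Longrightarrow> H (x, t) \<noteq> \<alpha> t"
    using adm by (auto simp: admissible_homotopy_def path_def proper_on_def)
  have "bounded (\<alpha> ` {0..1})"
    by (intro compact_imp_bounded compact_continuous_image c\<alpha>) auto
  then obtain M where M: "\<And>t. t \<in> {0..1} \<Longrightarrow> norm (\<alpha> t) \<le> M"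
    unfolding bounded_iff by blast
  \<comment> \<open>Since \<alpha> is bounded by \<open>M\<close>, distance at most 1 to \<alpha>
    forces \<open>H\<close> into the ball of radius \<open>M + 1\<close>.\<close>
  define C where "C = H -` cball 0 (M + 1) \<inter> closure U \<times> {0..1}"
  define N where "N z = norm (H z - \<alpha> (snd z))" for z
  have C: "compact C" unfolding C_def by (intro proper compact_cball)
  have "continuous_on (closure U \<times> {0..1}) (\<lambda>z. \<alpha> (snd z))"
    by (rule continuous_on_compose2[OF c\<alpha> continuous_on_snd[OF continuous_on_id]]) auto
  then have cN: "continuous_on (closure U \<times> {0..1}) N"
    unfolding N_def by (intro continuous_intros cH)
  have inC: "(x, t) \<in> C" if "x \<in> closure U" "t \<in> {0..1}" "N (x, t) \<le> 1" for x t
  proof -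
    have "norm (H (x, t)) \<le> norm (H (x, t) - \<alpha> t) + norm (\<alpha> t)"
      using norm_triangle_ineq[of "H (x, t) - \<alpha> t" "\<alpha> t"] by simp
    then show ?thesis using that M[OF that(2)] by (simp add: C_def N_def)
  qed
  define B where "B = C \<inter> (frontier U \<times> UNIV)"
  have "compact B" unfolding B_def by (intro compact_Int_closed C closed_Times) auto
  obtain m where m: "m > 0" "\<And>z. z \<in> B \<Longrightarrow> m \<le> N z"
  proof (cases "B = {}")
    case False
    have "continuous_on B N" by (rule continuous_on_subset[OF cN]) (auto simp: B_def C_def)
    from continuous_attains_inf[OF \<open>compact B\<close> False this] obtain y where
      y: "y \<in> B" "\<forall>z\<in>B. N y \<le> N z" by blast
    have "N y > 0" using y(1) bd[of "fst y" "snd y"] by (auto simp: B_def C_def N_def)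
    then show ?thesis using that[of "N y"] y(2) by blast
  qed (use that[of 1] in auto)
  \<comment> \<open>Being at most 1 places the relevant points in \<open>C\<close>; being strictly
    below \<open>m\<close> excludes the frontier.\<close>
  define \<rho> where "\<rho> = min 1 (m / 2)"
  have \<rho>: "\<rho> > 0" "\<rho> \<le> 1" "\<rho> < m" using m(1) by (auto simp: \<rho>_def min_def)
  \<comment> \<open>Projecting out the time gives one support valid for all times.\<close>
  define S where "S = fst ` {z \<in> C. N z \<le> \<rho>}"
  show ?thesis
  proof
    have "continuous_on C N" by (rule continuous_on_subset[OF cN]) (auto simp: C_def)
    then have "closed (C \<inter> N -` {..\<rho>})"
      by (rule continuous_closed_preimage) (use compact_imp_closed[OF C] in auto)
    then have "compact (C \<inter> (C \<inter> N -` {..\<rho>}))" by (intro compact_Int_closed C)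
    moreover have "C \<inter> (C \<inter> N -` {..\<rho>}) = {z \<in> C. N z \<le> \<rho>}" by auto
    ultimately show "compact S"
      unfolding S_def by (intro compact_continuous_image continuous_on_fst continuous_on_id) simp
    show "S \<subseteq> U"
    proof
      fix x assume "x \<in> S"
      then obtain z where z: "z \<in> C" "N z \<le> \<rho>" "x = fst z" by (auto simp: S_def)
      then have "x \<in> closure U" by (auto simp: C_def)
      moreover have "x \<notin> frontier U"
      proof
        assume "x \<in> frontier U"
        then have "z \<in> B" using z by (auto simp: B_def mem_Times_iff)
        then show False using m(2)[of z] z(2) \<rho> by simp
      qed
      ultimately show "x \<in> U" using U by (simp add: frontier_def interior_open)
    qed
    show "\<rho> > 0" by (rule \<rho>)
    show "\<rho> \<le> norm (H (x, t) - \<alpha> t)" if "x \<in> closure U - S" "t \<in> {0..1}" for x t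
    proof (rule ccontr)
      assume "\<not> \<rho> \<le> norm (H (x, t) - \<alpha> t)"
      then have "N (x, t) < \<rho>" by (simp add: N_def)
      moreover from this have "(x, t) \<in> C" using \<rho>(2) that by (intro inC) auto
      ultimately have "x \<in> S" unfolding S_def by (auto intro!: image_eqI[of _ _ "(x, t)"])
      then show False using that by simp
    qed
  qed
qed

text \<open>Regularity is given at times 0 and 1, so the degree formula is applied to these two
  slices and the invariance of the integral bridges the times between.\<close>

lemma deg_homotopy_invariant:
  fixes H :: "(real^'k) \<times> real \<Rightarrow> real^'k"
  assumes smooth: "smooth_homotopy H U \<alpha>" and adm: "admissible_homotopy H U \<alpha>"
    and R0: "regular_triple (\<lambda>x. H (x, 0)) U (\<alpha> 0)" and R1: "regular_triple (\<lambda>x. H (x, 1)) U (\<alpha> 1)"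
  shows "deg (\<lambda>x. H (x, 0)) U (\<alpha> 0) = deg (\<lambda>x. H (x, 1)) U (\<alpha> 1)"
proof -
  have U: "open U" using adm by (simp add: admissible_homotopy_def)
  obtain V h where h: "open V" "closure U \<times> {0..1} \<subseteq> V" "\<And>n. Ck_on n h V"
      "\<And>z. z \<in> closure U \<times> {0..1} \<Longrightarrow> h z = H z"
    using smooth unfolding smooth_homotopy_def smooth_on_def by metis
  obtain W a where a: "open W" "{0..1} \<subseteq> W" "\<And>n. Ck_on n a W" "\<And>t. t \<in> {0..1} \<Longrightarrow> a t = \<alpha> t"
    using smooth unfolding smooth_homotopy_def smooth_on_def by metis
  have "U \<times> {0..1} \<subseteq> V" using h(2) closure_subset by blast
  from smooth_homotopy_c2_homotopy[OF U h(1) this h(3) a(1-3)]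
  obtain Q P T R where hom: "c2_homotopy U (\<lambda>x t. h (x, t) - a t) Q P T R" by blast
  interpret c2_homotopy U "\<lambda>x t. h (x, t) - a t" Q P T R by (rule hom)
  have eq: "h (x, t) - a t = H (x, t) - \<alpha> t" if "x \<in> closure U" "t \<in> {0..1}" for x t
    using h(4) a(4) that by simp
  obtain S \<rho> where S: "compact S" "S \<subseteq> U" "\<rho> > 0"
    "\<And>x t. x \<in> closure U - S \<Longrightarrow> t \<in> {0..1} \<Longrightarrow> \<rho> \<le> norm (H (x, t) - \<alpha> t)"
    by (rule admissible_homotopy_compact_support[OF adm]) (rule that; assumption)
  define I where "I r t = integral UNIV (\<lambda>x. if x \<in> U then bump r (h (x, t) - a t) * det (\<chi> j. P j x t) else 0)" for r t
  define b where "b r = integral UNIV (bump r :: real^'k \<Rightarrow> real)" for r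
  have "\<exists>\<rho>>0. \<forall>r. 0 < r \<and> r \<le> \<rho> \<longrightarrow> I r 0 = real_of_int (deg (\<lambda>x. H (x, 0)) U (\<alpha> 0)) * b r"
    unfolding I_def b_def
    by (rule deg_integral_formula[OF R0 c2_homotopy_slice[OF hom, of 0]]) (simp_all add: eq)
  then obtain \<rho>0 where \<rho>0: "\<rho>0 > 0"
    "\<And>r. 0 < r \<Longrightarrow> r \<le> \<rho>0 \<Longrightarrow> I r 0 = real_of_int (deg (\<lambda>x. H (x, 0)) U (\<alpha> 0)) * b r" by blast
  have "\<exists>\<rho>>0. \<forall>r. 0 < r \<and> r \<le> \<rho> \<longrightarrow> I r 1 = real_of_int (deg (\<lambda>x. H (x, 1)) U (\<alpha> 1)) * b r"
    unfolding I_def b_def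
    by (rule deg_integral_formula[OF R1 c2_homotopy_slice[OF hom, of 1]]) (simp_all add: eq)
  then obtain \<rho>1 where \<rho>1: "\<rho>1 > 0"
    "\<And>r. 0 < r \<Longrightarrow> r \<le> \<rho>1 \<Longrightarrow> I r 1 = real_of_int (deg (\<lambda>x. H (x, 1)) U (\<alpha> 1)) * b r" by blast
  \<comment> \<open>One bump radius has to meet three demands: compact support along the homotopy
    and the degree formula at either end.\<close>
  define r where "r = min \<rho> (min \<rho>0 \<rho>1)"
  have r: "r > 0" "r \<le> \<rho>" "r \<le> \<rho>0" "r \<le> \<rho>1" using S(3) \<rho>0(1) \<rho>1(1) by (auto simp: r_def)
  have "I r 0 = I r 1"
    unfolding I_def
  proof (rule integral_bump_det_homotopy[OF S(1,2) r(1)])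
    fix x t assume x: "x \<in> U - S" and t: "t \<in> {0..1::real}"
    then have "x \<in> closure U - S" using closure_subset by blast
    from S(4)[OF this t] eq[OF _ t, of x] this r(2) show "r \<le> norm (h (x, t) - a t)" by simp
  qed
  moreover have "b r > 0" unfolding b_def by (rule integral_bump_pos[OF r(1)])
  ultimately show ?thesis using \<rho>0(2)[OF r(1,3)] \<rho>1(2)[OF r(1,4)] by simp
qed

section \<open>Normalization, additivity and the combined statement\<close>

lemma deg_identity: "deg (\<lambda>x::real^'k. x) UNIV 0 = 1"
proof -
  have "jacobian (\<lambda>x::real^'k. x) (at 0) = mat 1"
    by (simp add: jacobian_def frechet_derivative_ident matrix_id_mat_1[unfolded id_def])
  moreover have "(\<lambda>x::real^'k. x) -` {0} \<inter> UNIV = {0}" by auto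
  ultimately show ?thesis by (simp add: deg_def local_index_def)
qed

lemma deg_additive:
  assumes R: "regular_triple f U y"
    and s: "U1 \<subseteq> U" "U2 \<subseteq> U" "U1 \<inter> U2 = {}" "f -` {y} \<inter> U \<subseteq> U1 \<union> U2"
  shows "deg f U y = deg f U1 y + deg f U2 y"
proof -
  have "f -` {y} \<inter> U = (f -` {y} \<inter> U1) \<union> (f -` {y} \<inter> U2)" using s by blast
  moreover have "finite (f -` {y} \<inter> U1)" "finite (f -` {y} \<inter> U2)"
    using s by (auto intro: finite_subset[OF _ regular_triple_finite[OF R]])
  ultimately show ?thesis
    unfolding deg_def using s(3) by (simp add: sum.union_disjoint disjoint_iff)
qed

theorem theorem3p6:
  shows "deg (\<lambda>x::real^'k. x) UNIV 0 = 1 \<and>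
    (\<forall>(f :: real^'k \<Rightarrow> real^'k) U y U1 U2.
        regular_triple f U y \<and> open U1 \<and> open U2 \<and> U1 \<subseteq> U \<and> U2 \<subseteq> U \<and> U1 \<inter> U2 = {} \<and>
        f -` {y} \<inter> U \<subseteq> U1 \<union> U2 \<longrightarrow>
        deg f U y = deg f U1 y + deg f U2 y) \<and>
    (\<forall>(H :: (real^'k) \<times> real \<Rightarrow> real^'k) U \<alpha>.
        smooth_homotopy H U \<alpha> \<and> admissible_homotopy H U \<alpha> \<and>
        regular_triple (\<lambda>x. H (x, 0)) U (\<alpha> 0) \<and> regular_triple (\<lambda>x. H (x, 1)) U (\<alpha> 1) \<longrightarrow>
        deg (\<lambda>x. H (x, 0)) U (\<alpha> 0) = deg (\<lambda>x. H (x, 1)) U (\<alpha> 1))"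
proof (intro conjI allI impI; (elim conjE)?)
  show "deg (\<lambda>x::real^'k. x) UNIV 0 = 1" by (rule deg_identity)
next
  fix f :: "real^'k \<Rightarrow> real^'k" and U U1 U2 y
  assume "regular_triple f U y" "U1 \<subseteq> U" "U2 \<subseteq> U" "U1 \<inter> U2 = {}" "f -` {y} \<inter> U \<subseteq> U1 \<union> U2"
  then show "deg f U y = deg f U1 y + deg f U2 y" by (rule deg_additive)
next
  fix H :: "(real^'k) \<times> real \<Rightarrow> real^'k" and U \<alpha>
  assume "smooth_homotopy H U \<alpha>" "admissible_homotopy H U \<alpha>"
    "regular_triple (\<lambda>x. H (x, 0)) U (\<alpha> 0)" "regular_triple (\<lambda>x. H (x, 1)) U (\<alpha> 1)"
  then show "deg (\<lambda>x. H (x, 0)) U (\<alpha> 0) = deg (\<lambda>x. H (x, 1)) U (\<alpha> 1)" by (rule deg_homotopy_invariant)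
qed

end
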